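(* Let $\mathcal P$ be a poset of type $\mathbb A$ and let $\Bbbk$ be a field. Then for every indecomposable peak $\mathcal P$-space $\mathbf U$ over $\Bbbk$ there exists a weight $\boldsymbol\theta\in\operatorname{Hom}(\mathbb Z^{\mathcal P},\mathbb Z)$ such that $\mathbf U$ is $\boldsymbol\theta$-stable.
   Context: Peak $\mathcal P$-spaces. Let $(\mathcal P,\preceq)$ be a finite poset with set of maximal points $\max\mathcal P$. A peak $\mathcal P$-space over $\Bbbk$ is a system $\mathbf U=(U_x)_{x\in\mathcal P}$ of finite-dimensional $\Bbbk$-vector spaces such that each $U_x$ is a subspace of the ambient space $U^\bullet=\bigoplus_{z\in\max\mathcal P}U_z$ (for $z\in\max\mathcal P$, $U_z$ is the $z$-th summand), $\pi_z(U_x)=0$ whenever $z\in\max\mathcal P$ and $x\not\preceq z$, and $\pi_y(U_x)\subseteq U_y$ whenever $x\preceq y$. Here $\pi_y:U^\bullet\to U^\bullet$ is the natural projection onto $U^\bullet_y=\bigoplus_{y\preceq z\in\max\mathcal P}U_z$ followed by the inclusion of $U_y^\bullet$ in $U^\bullet$. A morphism $f:\mathbf U\to\mathbf U'$ is a family of linear maps $(f_z:U_z\to U'_z)_{z\in\max\mathcal P}$ such that $\bigoplus_z f_z$ maps $U_x$ into $U'_x$ for all $x\in\mathcal P$; it is an isomorphism if $\bigoplus_zf_z$ is bijective and maps $U_x$ onto $U'_x$ for all $x$. These objects form an additive category $\mathcal P\text{-spr}$. Proper peak $\mathcal P$-subspaces and stability. An admissible subspace of $U^\bullet$ is a subspace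 $K=\bigoplus_{z\in\max\mathcal P}K_z$ with $K_z\subseteq U_z$; it defines the peak $\mathcal P$-space $\mathbf U_K=(K\cap U_x)_{x\in\mathcal P}$. In the definition of stability, proper peak $\mathcal P$-subspaces are the $\mathbf U_K$ with $K$ admissible and $0\neq K\neq U^\bullet$. Put $\dim$-vector $\mathbf{dim}\,\mathbf U=(\dim U_x)_{x\in\mathcal P}\in\mathbb Z^{\mathcal P}$ and, for $\boldsymbol\theta\in\operatorname{Hom}(\mathbb Z^{\mathcal P},\mathbb Z)$, $\boldsymbol\theta(\mathbf U)=\boldsymbol\theta(\mathbf{dim}\,\mathbf U)$. $\mathbf U$ is $\boldsymbol\theta$-stable if $\boldsymbol\theta(\mathbf U)=0$ and $\boldsymbol\theta(\mathbf U_K)<0$ for every proper peak $\mathcal P$-subspace $\mathbf U_K$ of $\mathbf U$. Posets of type $\mathbb A$. A peak-subposet of $\mathcal P$ is a full subposet $\mathcal P'$ with $\max\mathcal P'\subseteq\max\mathcal P$. A finite connected poset $\mathcal P$ is of type $\mathbb A$ if it contains none of the following as a peak-subposet: $\mathcal R_1$: one maximal point with three pairwise incomparable points below it; $\mathcal R_2$: two maximal points $\star_1,\star_2$ and points $b\prec a$ with $a\prec\star_1$, $a\prec\star_2$; $\mathcal R_3$: three maximal points and one point below all three; $\mathcal R_{4,n}$ ($n\ge0$): maximal points $\star_1,\dots,\star_{n+2}$ and minimal points $b_1,\dots,b_{n+2}$ whose only strict relations are $b_1\prec\star_1$, $b_1\prec\star_{n+2}$ and $b_i\prec\star_{i-1}$,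 $b_i\prec\star_i$ for $2\le i\le n+2$. *)

theory Defs
  imports "HOL-Analysis.Product_Vector" "HOL-Library.Function_Algebras"
begin

section \<open>Posets of type A\<close>

text \<open>A finite poset is a type of class \<open>{finite, order}\<close>.\<close>

definition max_points :: "'p::order set" where
  "max_points = {z. \<forall>y. z \<le> y \<longrightarrow> y = z}"

definition peak_subposet :: "'p::order set \<Rightarrow> bool" where
  "peak_subposet S \<longleftrightarrow> {z \<in> S. \<forall>y\<in>S. z \<le> y \<longrightarrow> y = z} \<subseteq> max_points"

text \<open>
  A finite abstract poset is presented by a carrier \<open>A\<close> and its set \<open>R\<close> of strict relations.
  It is contained in \<open>'p\<close> if it is isomorphic to some peak-subposet of \<open>'p\<close>.
\<close>

definition contains_peak_subposet :: "'p::order itself \<Rightarrow> 'a set \<times> ('a \<times> 'a) set \<Rightarrow> bool" where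
  "contains_peak_subposet _ = (\<lambda>(A, R). \<exists>(S :: 'p set) \<phi>.
     peak_subposet S \<and> bij_betw \<phi> A S \<and> (\<forall>a\<in>A. \<forall>b\<in>A. \<phi> a < \<phi> b \<longleftrightarrow> (a, b) \<in> R))"

datatype point = Star nat | Below nat

definition poset_R1 :: "point set \<times> (point \<times> point) set" where
  "poset_R1 =
    ({Star 1, Below 1, Below 2, Below 3},
     {(Below 1, Star 1), (Below 2, Star 1), (Below 3, Star 1)})"

text \<open>Here \<open>Below 1\<close> is the point \<open>a\<close> and \<open>Below 2\<close> is the point \<open>b\<close> with \<open>b \<prec> a\<close>.\<close>

definition poset_R2 :: "point set \<times> (point \<times> point) set" where
  "poset_R2 =
    ({Star 1, Star 2, Below 1, Below 2},
     {(Below 2, Below 1), (Below 1, Star 1), (Below 1, Star 2),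
      (Below 2, Star 1), (Below 2, Star 2)})"

definition poset_R3 :: "point set \<times> (point \<times> point) set" where
  "poset_R3 =
    ({Star 1, Star 2, Star 3, Below 1},
     {(Below 1, Star 1), (Below 1, Star 2), (Below 1, Star 3)})"

definition poset_R4 :: "nat \<Rightarrow> point set \<times> (point \<times> point) set" where
  "poset_R4 n =
    (Star ` {1..n + 2} \<union> Below ` {1..n + 2},
     {(Below 1, Star 1), (Below 1, Star (n + 2))} \<union>
     (\<Union>i\<in>{2..n + 2}. {(Below i, Star (i - 1)), (Below i, Star i)}))"

definition connected_poset :: "'p::order itself \<Rightarrow> bool" where
  "connected_poset _ \<longleftrightarrow> (\<forall>x y :: 'p. (\<lambda>a b. a \<le> b \<or> b \<le> a)\<^sup>*\<^sup>* x y)"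

definition type_A :: "'p::{finite, order} itself \<Rightarrow> bool" where
  "type_A P \<longleftrightarrow> connected_poset P \<and>
     \<not> contains_peak_subposet P poset_R1 \<and>
     \<not> contains_peak_subposet P poset_R2 \<and>
     \<not> contains_peak_subposet P poset_R3 \<and>
     (\<forall>n. \<not> contains_peak_subposet P (poset_R4 n))"


section \<open>Peak spaces\<close>

text \<open>
  All spaces \<open>U\<^sub>z\<close>, for \<open>z\<close> maximal, are realised inside one vector space \<open>'v\<close> with
  scalar multiplication \<open>s\<close>.  Elements of an external direct sum of them are functions
  \<open>'p \<Rightarrow> 'v\<close> that vanish off the maximal points.  A system \<open>U\<close> therefore has type
  \<open>'p \<Rightarrow> ('p \<Rightarrow> 'v) set\<close>; for maximal \<open>z\<close>, \<open>U z\<close> consists of functions supported at \<open>z\<close>, and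
  \<open>summand U z\<close> is the corresponding subset of \<open>'v\<close>.
\<close>

definition fun_scale :: "('k \<Rightarrow> 'v \<Rightarrow> 'v) \<Rightarrow> 'k \<Rightarrow> ('p \<Rightarrow> 'v) \<Rightarrow> 'p \<Rightarrow> 'v" where
  "fun_scale s c u = (\<lambda>z. s c (u z))"

definition at_point :: "'p \<Rightarrow> 'v::zero \<Rightarrow> 'p \<Rightarrow> 'v" where
  "at_point z v = (\<lambda>w. if w = z then v else 0)"

definition summand :: "('p \<Rightarrow> ('p \<Rightarrow> 'v::zero) set) \<Rightarrow> 'p \<Rightarrow> 'v set" where
  "summand U z = {v. at_point z v \<in> U z}"

definition max_sum :: "('p::order \<Rightarrow> 'v::zero set) \<Rightarrow> ('p \<Rightarrow> 'v) set" where
  "max_sum V = {u. \<forall>z. if z \<in> max_points then u z \<in> V z else u z = 0}"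

definition ambient :: "('p::order \<Rightarrow> ('p \<Rightarrow> 'v::zero) set) \<Rightarrow> ('p \<Rightarrow> 'v) set" where
  "ambient U = max_sum (summand U)"

definition projection :: "'p::order \<Rightarrow> ('p \<Rightarrow> 'v::zero) \<Rightarrow> 'p \<Rightarrow> 'v" where
  "projection y u = (\<lambda>z. if y \<le> z then u z else 0)"

definition fin_dim_subspace :: "('k::field \<Rightarrow> 'v::ab_group_add \<Rightarrow> 'v) \<Rightarrow> 'v set \<Rightarrow> bool" where
  "fin_dim_subspace s W \<longleftrightarrow> module.subspace s W \<and> (\<exists>B. finite B \<and> module.span s B = W)"

definition peak_space ::
  "('k::field \<Rightarrow> 'v::ab_group_add \<Rightarrow> 'v) \<Rightarrow> ('p::{finite, order} \<Rightarrow> ('p \<Rightarrow> 'v) set) \<Rightarrow> bool" where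
  "peak_space s U \<longleftrightarrow>
     (\<forall>x. fin_dim_subspace (fun_scale s) (U x)) \<and>
     (\<forall>z\<in>max_points. U z = at_point z ` summand U z) \<and>
     (\<forall>x. U x \<subseteq> ambient U) \<and>
     (\<forall>x. \<forall>z\<in>max_points. \<not> x \<le> z \<longrightarrow> projection z ` U x = {0}) \<and>
     (\<forall>x y. x \<le> y \<longrightarrow> projection y ` U x \<subseteq> U y)"


section \<open>Morphisms and indecomposability\<close>

definition linear_map_on ::
  "('k::field \<Rightarrow> 'v::ab_group_add \<Rightarrow> 'v) \<Rightarrow> ('k \<Rightarrow> 'w::ab_group_add \<Rightarrow> 'w) \<Rightarrow>
   'v set \<Rightarrow> 'w set \<Rightarrow> ('v \<Rightarrow> 'w) \<Rightarrow> bool" where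
  "linear_map_on s t V W f \<longleftrightarrow> f ` V \<subseteq> W \<and>
     (\<forall>a\<in>V. \<forall>b\<in>V. f (a + b) = f a + f b) \<and> (\<forall>c. \<forall>a\<in>V. f (s c a) = t c (f a))"

definition sum_map ::
  "('p::order \<Rightarrow> 'v \<Rightarrow> 'w::zero) \<Rightarrow> ('p \<Rightarrow> 'v) \<Rightarrow> 'p \<Rightarrow> 'w" where
  "sum_map f u = (\<lambda>z. if z \<in> max_points then f z (u z) else 0)"

definition peak_morphism ::
  "('k::field \<Rightarrow> 'v::ab_group_add \<Rightarrow> 'v) \<Rightarrow> ('k \<Rightarrow> 'w::ab_group_add \<Rightarrow> 'w) \<Rightarrow>
   ('p::{finite, order} \<Rightarrow> ('p \<Rightarrow> 'v) set) \<Rightarrow> ('p \<Rightarrow> ('p \<Rightarrow> 'w) set) \<Rightarrow>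
   ('p \<Rightarrow> 'v \<Rightarrow> 'w) \<Rightarrow> bool" where
  "peak_morphism s t U U' f \<longleftrightarrow>
     (\<forall>z\<in>max_points. linear_map_on s t (summand U z) (summand U' z) (f z)) \<and>
     (\<forall>x. sum_map f ` U x \<subseteq> U' x)"

definition peak_isomorphic ::
  "('k::field \<Rightarrow> 'v::ab_group_add \<Rightarrow> 'v) \<Rightarrow> ('k \<Rightarrow> 'w::ab_group_add \<Rightarrow> 'w) \<Rightarrow>
   ('p::{finite, order} \<Rightarrow> ('p \<Rightarrow> 'v) set) \<Rightarrow> ('p \<Rightarrow> ('p \<Rightarrow> 'w) set) \<Rightarrow> bool" where
  "peak_isomorphic s t U U' \<longleftrightarrow> (\<exists>f. peak_morphism s t U U' f \<and>
     bij_betw (sum_map f) (ambient U) (ambient U') \<and> (\<forall>x. sum_map f ` U x = U' x))"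

definition peak_direct_sum ::
  "('p \<Rightarrow> ('p \<Rightarrow> 'v) set) \<Rightarrow> ('p \<Rightarrow> ('p \<Rightarrow> 'w) set) \<Rightarrow> 'p \<Rightarrow> ('p \<Rightarrow> 'v \<times> 'w) set" where
  "peak_direct_sum U U' x = {(\<lambda>z. (u z, u' z)) | u u'. u \<in> U x \<and> u' \<in> U' x}"

definition zero_peak_space :: "('p \<Rightarrow> ('p \<Rightarrow> 'v::zero) set) \<Rightarrow> bool" where
  "zero_peak_space U \<longleftrightarrow> (\<forall>x. U x = {0})"

text \<open>
  Only summands realised over the same vector space \<open>'v\<close> are considered.  This is no restriction:
  if \<open>U\<close> is isomorphic to a direct sum, then the spaces at the maximal points of each summand
  embed into those of \<open>U\<close>, so that each summand is isomorphic to a peak space over \<open>'v\<close>.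
\<close>

definition indecomposable_peak_space ::
  "('k::field \<Rightarrow> 'v::ab_group_add \<Rightarrow> 'v) \<Rightarrow> ('p::{finite, order} \<Rightarrow> ('p \<Rightarrow> 'v) set) \<Rightarrow> bool" where
  "indecomposable_peak_space s U \<longleftrightarrow> peak_space s U \<and> \<not> zero_peak_space U \<and>
     (\<forall>U' U''. peak_space s U' \<and> peak_space s U'' \<and>
        peak_isomorphic s (module_prod.scale s s) U (peak_direct_sum U' U'') \<longrightarrow>
        zero_peak_space U' \<or> zero_peak_space U'')"


section \<open>Stability\<close>

definition admissible ::
  "('k::field \<Rightarrow> 'v::ab_group_add \<Rightarrow> 'v) \<Rightarrow> ('p::{finite, order} \<Rightarrow> ('p \<Rightarrow> 'v) set) \<Rightarrow>
   ('p \<Rightarrow> 'v) set \<Rightarrow> bool" where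
  "admissible s U K \<longleftrightarrow>
     (\<exists>L. (\<forall>z\<in>max_points. module.subspace s (L z) \<and> L z \<subseteq> summand U z) \<and> K = max_sum L)"

definition restrict_peak_space :: "('p \<Rightarrow> ('p \<Rightarrow> 'v) set) \<Rightarrow> ('p \<Rightarrow> 'v) set \<Rightarrow> 'p \<Rightarrow> ('p \<Rightarrow> 'v) set" where
  "restrict_peak_space U K x = K \<inter> U x"

definition dim_vector ::
  "('k::field \<Rightarrow> 'v::ab_group_add \<Rightarrow> 'v) \<Rightarrow> ('p \<Rightarrow> ('p \<Rightarrow> 'v) set) \<Rightarrow> 'p \<Rightarrow> int" where
  "dim_vector s U x = int (vector_space.dim (fun_scale s) (U x))"

text \<open>A weight is an additive map \<open>\<theta> :: ('p \<Rightarrow> int) \<Rightarrow> int\<close>.\<close>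

definition peak_stable ::
  "('k::field \<Rightarrow> 'v::ab_group_add \<Rightarrow> 'v) \<Rightarrow> (('p::{finite, order} \<Rightarrow> int) \<Rightarrow> int) \<Rightarrow>
   ('p \<Rightarrow> ('p \<Rightarrow> 'v) set) \<Rightarrow> bool" where
  "peak_stable s \<theta> U \<longleftrightarrow> \<theta> (dim_vector s U) = 0 \<and>
     (\<forall>K. admissible s U K \<and> K \<noteq> {0} \<and> K \<noteq> ambient U \<longrightarrow>
        \<theta> (dim_vector s (restrict_peak_space U K)) < 0)"

end

theory Submission
  imports Defs
begin

text \<open>
  For the nonzero peaks of \<open>U\<close>, linked when they have a common lower point, the exclusion of the
  posets \<open>R\<^sub>1\<close>, \<open>R\<^sub>3\<close> and \<open>R\<^sub>4\<close> forces a connected component to be a path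
  \<open>z\<^sub>0, \<dots>, z\<^sub>m\<close>, where consecutive peaks share exactly one lower point, a minimal one.
  Its subspace is a linear relation between \<open>U\<close> at the two peaks.  Going along the path and transporting
  subspaces through these relations, one obtains at \<open>z\<^sub>m\<close> a family of subspaces no three of which are
  pairwise incomparable.  Such a family admits a vector \<open>v\<close> and a functional \<open>h\<close> with \<open>h v = 1\<close>
  such that each member contains \<open>v\<close> or is killed by \<open>h\<close>, and the pair lifts back along the path until the
  relations let it stop.  The rank one projections \<open>h(-)v\<close> then form an idempotent endomorphism of
  \<open>U\<close>, which must be the identity if \<open>U\<close> is indecomposable.  So \<open>U\<close> is a string of
  \<open>n\<close> lines joined by \<open>n - 1\<close> diagonals; an admissible subspace with \<open>c\<close> of these lines
  contains at most \<open>c - 1\<close> of the diagonals if \<open>c > 0\<close>, and the weight \<open>n\<close> on the diagonals and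
  \<open>-(n - 1)\<close> on the lines gives at most \<open>n(c - 1) - (n - 1)c = c - n\<close>.
\<close>

section \<open>Posets of type A\<close>

text \<open>The last premise makes the image a peak-subposet: a point that is maximal in the image
  has nothing of the image above it, so it is a peak of the whole poset.\<close>

lemma contains_peak_subposetI:
  fixes \<phi> :: "'a \<Rightarrow> 'p::order"
  assumes "inj_on \<phi> A"
    and "\<And>a b. a \<in> A \<Longrightarrow> b \<in> A \<Longrightarrow> \<phi> a < \<phi> b \<longleftrightarrow> (a, b) \<in> R"
    and "\<And>a. a \<in> A \<Longrightarrow> \<phi> a \<in> max_points \<or> (\<exists>b\<in>A. \<phi> a < \<phi> b)"
  shows "contains_peak_subposet TYPE('p) (A, R)"
proof -
  have "peak_subposet (\<phi> ` A)"
    unfolding peak_subposet_def using assms(3) by (force simp: less_le)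
  then show ?thesis
    unfolding contains_peak_subposet_def
    using assms(1,2) by (auto simp: inj_on_imp_bij_betw intro!: exI[of _ "\<phi> ` A"] exI[of _ \<phi>])
qed

lemma max_points_le: "z \<in> max_points \<Longrightarrow> z \<le> y \<Longrightarrow> y = z"
  by (auto simp: max_points_def)

lemma max_points_not_less: "z \<in> max_points \<Longrightarrow> \<not> z < y"
  by (auto simp: max_points_def less_le)

lemma max_points_lessI: "x \<le> y \<Longrightarrow> x \<le> z \<Longrightarrow> y \<in> max_points \<Longrightarrow> z \<in> max_points \<Longrightarrow> y \<noteq> z \<Longrightarrow> x < y"
  using max_points_le by (metis order.not_eq_order_implies_strict)

section \<open>Local consequences of the excluded peak-subposets\<close>

locale type_A_poset =
  fixes dummy :: "'p::{finite, order} itself"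
  assumes type_A: "type_A TYPE('p)"
begin

text \<open>Otherwise \<open>z\<close> and the three points form \<open>poset_R1\<close>.\<close>

lemma width_le_2:
  fixes a b c z :: 'p
  assumes "z \<in> max_points" "a < z" "b < z" "c < z"
  shows "a \<le> b \<or> b \<le> a \<or> a \<le> c \<or> c \<le> a \<or> b \<le> c \<or> c \<le> b"
proof (rule ccontr)
  assume inc: "\<not> ?thesis"
  define \<phi> where "\<phi> p = (case p of Star _ \<Rightarrow> z | Below n \<Rightarrow> if n = 1 then a else if n = 2 then b else c)" for p
  have "contains_peak_subposet TYPE('p) poset_R1"
    unfolding poset_R1_def
  proof (rule contains_peak_subposetI[where \<phi> = \<phi>])
    show "inj_on \<phi> {Star 1, Below 1, Below 2, Below 3}"
      using inc assms by (auto simp: inj_on_def \<phi>_def)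
  qed (use inc assms max_points_not_less[OF assms(1)] in \<open>auto simp: \<phi>_def less_le\<close>)
  with type_A show False
    by (auto simp: type_A_def)
qed

text \<open>Exclusion of \<open>poset_R3\<close>: being below different peaks makes \<open>x\<close>
  strictly smaller than each of them.\<close>

lemma at_most_two_peaks:
  fixes x y1 y2 y3 :: 'p
  assumes le: "x \<le> y1" "x \<le> y2" "x \<le> y3"
    and mx: "y1 \<in> max_points" "y2 \<in> max_points" "y3 \<in> max_points"
  shows "y1 = y2 \<or> y1 = y3 \<or> y2 = y3"
proof (rule ccontr)
  assume d: "\<not> ?thesis"
  have lt: "x < y1" "x < y2" "x < y3"
    using d le mx max_points_lessI by metis+
  define \<phi> where "\<phi> p = (case p of Below _ \<Rightarrow> x | Star n \<Rightarrow> if n = 1 then y1 else if n = 2 then y2 else y3)" for p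
  have "contains_peak_subposet TYPE('p) poset_R3"
    unfolding poset_R3_def
  proof (rule contains_peak_subposetI[where \<phi> = \<phi>])
    show "inj_on \<phi> {Star 1, Star 2, Star 3, Below 1}"
      using d lt by (auto simp: inj_on_def \<phi>_def)
  qed (use lt mx max_points_not_less[OF mx(1)] max_points_not_less[OF mx(2)] max_points_not_less[OF mx(3)] in
      \<open>auto simp: \<phi>_def\<close>)
  with type_A show False
    by (auto simp: type_A_def)
qed

text \<open>Otherwise the two peaks, \<open>a\<close> and \<open>b\<close> form
  \<open>poset_R2\<close>. Common lower points of different peaks are thus minimal in the whole
  poset.\<close>

lemma common_lower_not_less:
  fixes a b y z :: 'p
  assumes le: "a \<le> y" "a \<le> z" and mx: "y \<in> max_points" "z \<in> max_points" and "y \<noteq> z"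
  shows "\<not> b < a"
proof
  assume ba: "b < a"
  have lt: "a < y" "a < z"
    using assms max_points_lessI by metis+
  have lt': "b < y" "b < z"
    using lt ba by auto
  define \<phi> where "\<phi> p = (case p of Below n \<Rightarrow> if n = 1 then a else b | Star n \<Rightarrow> if n = 1 then y else z)" for p
  have "contains_peak_subposet TYPE('p) poset_R2"
    unfolding poset_R2_def
  proof (rule contains_peak_subposetI[where \<phi> = \<phi>])
    show "inj_on \<phi> {Star 1, Star 2, Below 1, Below 2}"
      using lt lt' ba assms(5) by (auto simp: inj_on_def \<phi>_def)
  qed (use lt lt' ba mx max_points_not_less[OF mx(1)] max_points_not_less[OF mx(2)] less_not_sym[OF ba] in
      \<open>auto simp: \<phi>_def\<close>)
  with type_A show False
    by (auto simp: type_A_def)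
qed

text \<open>Two different common lower points are both minimal, hence incomparable, and together
  with \<open>y\<close> and \<open>z\<close> they form the shortest crown
  \<open>poset_R4 0\<close>.\<close>

lemma common_lower_unique:
  fixes a b y z :: 'p
  assumes a: "a \<le> y" "a \<le> z" and b: "b \<le> y" "b \<le> z"
    and mx: "y \<in> max_points" "z \<in> max_points" and "y \<noteq> z"
  shows "a = b"
proof (rule ccontr)
  assume "a \<noteq> b"
  moreover have inc: "\<not> a < b" "\<not> b < a"
    using common_lower_not_less assms by blast+
  moreover have lt: "a < y" "a < z" "b < y" "b < z"
    using assms max_points_lessI by metis+
  define \<phi> where "\<phi> p = (case p of Below n \<Rightarrow> if n = 1 then a else b | Star n \<Rightarrow> if n = 1 then y else z)" for p
  have I: "{1..0 + 2} = {1, 2 :: nat}" "{2..0 + 2} = {2 :: nat}"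
    by auto
  have R4: "poset_R4 0 = ({Star 1, Star 2, Below 1, Below 2},
      {(Below 1, Star 1), (Below 1, Star 2), (Below 2, Star 1), (Below 2, Star 2)})"
    unfolding poset_R4_def I by (simp add: insert_commute flip: numeral_2_eq_2)
  have "contains_peak_subposet TYPE('p) (poset_R4 0)"
    unfolding R4
  proof (rule contains_peak_subposetI[where \<phi> = \<phi>])
    show "inj_on \<phi> {Star 1, Star 2, Below 1, Below 2}"
      using lt \<open>a \<noteq> b\<close> assms(7) by (auto simp: inj_on_def \<phi>_def)
  qed (use lt inc mx max_points_not_less[OF mx(1)] max_points_not_less[OF mx(2)] in \<open>auto simp: \<phi>_def\<close>)
  with type_A show False
    by (auto simp: type_A_def)
qed

text \<open>A closed cycle of peaks joined by common lower points is a copy of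
  \<open>poset_R4 n\<close>. For \<open>n = 0\<close> the points \<open>q\<close> and
  \<open>p 0\<close> could coincide; two peaks are the subject of
  \<open>common_lower_unique\<close>.\<close>

lemma no_cycle:
  fixes c p :: "nat \<Rightarrow> 'p"
  assumes n: "n \<ge> 1"
    and inj: "inj_on c {..Suc n}"
    and mx: "\<And>j. j \<le> Suc n \<Longrightarrow> c j \<in> max_points"
    and p: "\<And>j. j \<le> n \<Longrightarrow> p j \<le> c j" "\<And>j. j \<le> n \<Longrightarrow> p j \<le> c (Suc j)"
    and q: "q \<le> c 0" "q \<le> c (Suc n)"
  shows False
proof -
  let ?I = "{1..n + 2}"
  \<comment> \<open>\<open>N i\<close> collects the indices of the two stars above
    \<open>Below i\<close>, with the wrap-around at \<open>i = 1\<close>; the relation of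
    \<open>poset_R4 n\<close> becomes one uniform union.\<close>
  define N :: "nat \<Rightarrow> nat set" where "N i = (if i = 1 then {1, n + 2} else {i - 1, i})" for i
  \<comment> \<open>Stars are numbered from 1 and the peaks \<open>c\<close> from 0. For
    \<open>i \<ge> 2\<close> the stars above \<open>Below i\<close> are thus
    \<open>c (i - 2)\<close> and \<open>c (i - 1)\<close>, which are joined by
    \<open>p (i - 2)\<close>.\<close>
  define \<phi> where "\<phi> x = (case x of Star i \<Rightarrow> c (i - 1) | Below i \<Rightarrow> if i = 1 then q else p (i - 2))" for x
  have R: "poset_R4 n = (Star ` ?I \<union> Below ` ?I, (\<Union>i\<in>?I. (\<lambda>k. (Below i, Star k)) ` N i))"
  proof -
    have "(\<Union>i\<in>{2..n + 2}. {(Below i, Star (i - 1)), (Below i, Star i)}) =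
        (\<Union>i\<in>{2..n + 2}. (\<lambda>k. (Below i, Star k)) ` N i)"
      by (rule SUP_cong) (auto simp: N_def)
    moreover have "{(Below 1, Star 1), (Below 1, Star (n + 2))} = (\<lambda>k. (Below 1, Star k)) ` N 1"
      by (simp add: N_def)
    moreover have "?I = insert 1 {2..n + 2}"
      by auto
    ultimately show ?thesis
      unfolding poset_R4_def by (simp only: UN_insert)
  qed
  have N_le: "\<phi> (Below i) \<le> \<phi> (Star k)" if "i \<in> ?I" "k \<in> N i" for i k
  proof (cases "i = 1")
    case False
    define j where "j = i - 2"
    have "i = j + 2" "j \<le> n"
      using that False by (auto simp: j_def)
    then show ?thesis
      using that p[of j] by (auto simp: \<phi>_def N_def)
  qed (use that q in \<open>auto simp: \<phi>_def N_def\<close>)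
  have star_mx: "\<phi> (Star k) \<in> max_points" if "k \<in> ?I" for k
    using mx[of "k - 1"] that by (auto simp: \<phi>_def)
  have star_inj: "\<phi> (Star k) = \<phi> (Star l) \<longleftrightarrow> k = l" if "k \<in> ?I" "l \<in> ?I" for k l
  proof -
    have "c (k - 1) = c (l - 1) \<longleftrightarrow> k - 1 = l - 1"
      using that by (intro inj_on_eq_iff[OF inj]) auto
    then show ?thesis
      using that by (auto simp: \<phi>_def)
  qed
  have N_sub: "N i \<subseteq> ?I" if "i \<in> ?I" for i
    using that by (auto simp: N_def)
  have N2: "\<exists>k l. N i = {k, l} \<and> k \<noteq> l" if "i \<in> ?I" for i
  proof (cases "i = 1")
    case True
    then show ?thesis
      by (intro exI[of _ 1] exI[of _ "n + 2"]) (auto simp: N_def)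
  next
    case False
    then show ?thesis
      using that by (intro exI[of _ "i - 1"] exI[of _ i]) (auto simp: N_def)
  qed
  \<comment> \<open>A star above \<open>Below i\<close> that is not in \<open>N i\<close> would be a
    third peak there, against \<open>at_most_two_peaks\<close>.\<close>
  have le_iff: "\<phi> (Below i) \<le> \<phi> (Star k) \<longleftrightarrow> k \<in> N i" if i: "i \<in> ?I" and k: "k \<in> ?I" for i k
  proof
    assume le: "\<phi> (Below i) \<le> \<phi> (Star k)"
    obtain l l' where l: "N i = {l, l'}" "l \<noteq> l'"
      using N2[OF i] by blast
    moreover have "l \<in> ?I" "l' \<in> ?I"
      using N_sub[OF i] l by auto
    ultimately show "k \<in> N i"
      using at_most_two_peaks[OF le N_le[OF i, of l] N_le[OF i, of l'] star_mx[OF k] star_mx[of l] star_mx[of l']]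
        star_inj k by auto
  qed (use N_le that in blast)
  \<comment> \<open>For \<open>n = 0\<close> this fails, as \<open>N 1\<close> and
    \<open>N 2\<close> are both \<open>{1, 2}\<close>.\<close>
  have N_inj: "i = j" if "i \<in> ?I" "j \<in> ?I" "N i = N j" for i j
    using that n by (auto simp: N_def doubleton_eq_iff split: if_splits)
  \<comment> \<open>The stars above the larger point are above the smaller one too; both sets have
    two elements, so they agree.\<close>
  have below_le: "i = j" if i: "i \<in> ?I" and j: "j \<in> ?I" and le: "\<phi> (Below i) \<le> \<phi> (Below j)" for i j
  proof -
    have "N j \<subseteq> N i"
      using le_iff[OF i] le N_le[OF j] N_sub[OF j] by (meson order_trans subset_iff)
    then have "N i = N j"
      using N2[OF i] N2[OF j] by auto
    then show ?thesis
      using N_inj i j by blast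
  qed
  have lt_star: "\<phi> (Below i) < \<phi> (Star k) \<longleftrightarrow> k \<in> N i" if i: "i \<in> ?I" and k: "k \<in> ?I" for i k
  proof -
    have "\<phi> (Below i) \<noteq> \<phi> (Star k)"
    proof
      assume eq: "\<phi> (Below i) = \<phi> (Star k)"
      obtain l l' where l: "N i = {l, l'}" "l \<noteq> l'"
        using N2[OF i] by blast
      moreover have "l \<in> ?I" "l' \<in> ?I"
        using N_sub[OF i] l by auto
      ultimately show False
        using max_points_le[OF star_mx[OF k], of "\<phi> (Star l)"] max_points_le[OF star_mx[OF k], of "\<phi> (Star l')"]
          N_le[OF i, of l] N_le[OF i, of l'] eq star_inj[of l l'] by simp
    qed
    then show ?thesis
      using le_iff[OF i k] by (auto simp: less_le)
  qed
  have ne: "\<phi> (Below i) \<noteq> \<phi> (Star k)" if "i \<in> ?I" and "k \<in> ?I" for i k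
    using lt_star[OF that] le_iff[OF that] by (auto simp: less_le)
  have "contains_peak_subposet TYPE('p) (poset_R4 n)"
    unfolding R
  proof (rule contains_peak_subposetI[where \<phi> = \<phi>])
    show "inj_on \<phi> (Star ` ?I \<union> Below ` ?I)"
    proof (rule inj_onI)
      fix a b
      assume "a \<in> Star ` ?I \<union> Below ` ?I" "b \<in> Star ` ?I \<union> Below ` ?I" and eq: "\<phi> a = \<phi> b"
      then consider i j where "a = Star i" "b = Star j" "i \<in> ?I" "j \<in> ?I"
        | i j where "a = Below i" "b = Below j" "i \<in> ?I" "j \<in> ?I"
        | i j where "a = Star i" "b = Below j" "i \<in> ?I" "j \<in> ?I"
        | i j where "a = Below i" "b = Star j" "i \<in> ?I" "j \<in> ?I"
        by blast
      then show "a = b"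
      proof cases
        case 1 then show ?thesis using star_inj eq by blast
      next
        case 2 then show ?thesis using below_le[of i j] eq by simp
      next
        case 3 then show ?thesis using ne[of j i] eq by simp
      next
        case 4 then show ?thesis using ne[of i j] eq by simp
      qed
    qed
    show "\<phi> a < \<phi> b \<longleftrightarrow> (a, b) \<in> (\<Union>i\<in>?I. (\<lambda>k. (Below i, Star k)) ` N i)"
      if "a \<in> Star ` ?I \<union> Below ` ?I" "b \<in> Star ` ?I \<union> Below ` ?I" for a b
    proof (cases a)
      case (Star k)
      then show ?thesis
        using that max_points_not_less[OF star_mx[of k]] by auto
    next
      case a: (Below i)
      then have i: "i \<in> ?I" using that(1) by auto
      show ?thesis
      proof (cases b)
        case (Star k)
        then have "k \<in> ?I" using that(2) by auto
        from lt_star[OF i this] show ?thesis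
          using a Star i by auto
      next
        case (Below j)
        then have "j \<in> ?I" using that(2) by auto
        from below_le[OF i this] have "\<not> \<phi> (Below i) < \<phi> (Below j)"
          by (auto simp: less_le)
        then show ?thesis
          using a Below by auto
      qed
    qed
    show "\<phi> a \<in> max_points \<or> (\<exists>b\<in>Star ` ?I \<union> Below ` ?I. \<phi> a < \<phi> b)" if "a \<in> Star ` ?I \<union> Below ` ?I" for a
      using that
    proof
      assume "a \<in> Below ` ?I"
      then obtain i where i: "a = Below i" "i \<in> ?I" by auto
      then obtain l where l: "l \<in> N i" "l \<in> ?I"
        using N2[of i] N_sub[of i] by blast
      then show ?thesis
        using lt_star[of i l] i by blast
    qed (use star_mx in auto)
  qed
  with type_A show False
    by (auto simp: type_A_def)
qed

section \<open>The link graph on the peaks\<close>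

definition linked :: "'p \<Rightarrow> 'p \<Rightarrow> bool" where
  "linked y z \<longleftrightarrow> y \<noteq> z \<and> (\<exists>x. x \<le> y \<and> x \<le> z)"

lemma linked_sym: "linked y z \<Longrightarrow> linked z y"
  by (auto simp: linked_def)

text \<open>Points witnessing the three links lie strictly below \<open>z\<close>. If two of them
  were comparable, a point would lie below three peaks; so they form an antichain of size three,
  which \<open>width_le_2\<close> forbids.\<close>

lemma at_most_two_linked:
  assumes mx: "z \<in> max_points" "y1 \<in> max_points" "y2 \<in> max_points" "y3 \<in> max_points"
    and l: "linked z y1" "linked z y2" "linked z y3"
  shows "y1 = y2 \<or> y1 = y3 \<or> y2 = y3"
proof (rule ccontr)
  assume d: "\<not> ?thesis"
  obtain x1 x2 x3 where x: "x1 \<le> z" "x1 \<le> y1" "x2 \<le> z" "x2 \<le> y2" "x3 \<le> z" "x3 \<le> y3"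
    and ne: "z \<noteq> y1" "z \<noteq> y2" "z \<noteq> y3"
    using l by (auto simp: linked_def)
  have lt: "x1 < z" "x2 < z" "x3 < z"
    using x ne mx max_points_lessI by metis+
  have *: "\<not> a \<le> b" if "a \<le> z" "a \<le> y" "b \<le> y'" "y \<in> max_points" "y' \<in> max_points" "y \<noteq> y'" "z \<noteq> y" "z \<noteq> y'"
    for a b y y' :: 'p
    using at_most_two_peaks[of a z y y'] order_trans[of a b y'] that mx by blast
  show False
    using width_le_2[OF mx(1) lt] * x ne mx d by metis
qed

text \<open>The path is a longest one: \<open>no_cycle\<close> excludes chords, and \<open>at_most_two_linked\<close> branches.\<close>
lemma component_is_path:
  fixes Z :: "'p set"
  assumes Z: "Z \<subseteq> max_points" "Z \<noteq> {}"
  obtains m and zz :: "nat \<Rightarrow> 'p" where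
    "inj_on zz {..m}" "zz ` {..m} \<subseteq> Z" "\<And>j. j < m \<Longrightarrow> linked (zz j) (zz (Suc j))"
    "\<And>j y. j \<le> m \<Longrightarrow> y \<in> Z \<Longrightarrow> linked (zz j) y \<Longrightarrow> \<exists>k\<le>m. y = zz k \<and> (k = Suc j \<or> j = Suc k)"
proof -
  define path where "path m zz \<longleftrightarrow> inj_on zz {..m} \<and> zz ` {..m} \<subseteq> Z \<and>
    (\<forall>j<m. linked (zz j) (zz (Suc j)))" for m and zz :: "nat \<Rightarrow> 'p"
  obtain z where "z \<in> Z" using Z by auto
  then have path0: "path 0 (\<lambda>_. z)"
    by (auto simp: path_def)
  \<comment> \<open>The vertices of a path are distinct, so its length is bounded and a longest path
    exists.\<close>
  have bound: "m < card (UNIV :: 'p set) + 1" if ex: "\<exists>zz. path m zz" for m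
  proof -
    obtain zz where "path m zz" using ex by blast
    then have "card {..m} \<le> card (UNIV :: 'p set)"
      unfolding path_def by (metis card_inj_on_le finite_class.finite_UNIV subset_UNIV)
    then show ?thesis by auto
  qed
  obtain m where m: "\<exists>zz. path m zz" and max: "\<And>k. \<exists>zz. path k zz \<Longrightarrow> k \<le> m"
    using Nat.ex_has_greatest_nat[of "\<lambda>m. \<exists>zz. path m zz" 0 "card (UNIV :: 'p set) + 1"] path0 bound
    by (metis less_imp_le)
  obtain zz where zz: "path m zz" using m by blast
  have inj: "inj_on zz {..m}" and sub: "zz ` {..m} \<subseteq> Z" and lk: "\<And>j. j < m \<Longrightarrow> linked (zz j) (zz (Suc j))"
    using zz by (auto simp: path_def)
  have mx: "zz j \<in> max_points" if "j \<le> m" for j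
    using that sub Z(1) by auto
  \<comment> \<open>A chord closes the segment from \<open>j\<close> to \<open>k\<close> to a cycle
    of \<open>n + 2\<close> peaks, and \<open>n \<ge> 1\<close> because its ends are not
    consecutive.\<close>
  have chord: "k = Suc j" if jk: "j < k" "k \<le> m" and l: "linked (zz j) (zz k)" for j k
  proof (rule ccontr)
    assume "k \<noteq> Suc j"
    define n where "n = k - j - 1"
    have n: "n \<ge> 1" "k = j + Suc n"
      using jk \<open>k \<noteq> Suc j\<close> by (auto simp: n_def)
    have "\<forall>i. \<exists>x. i \<le> n \<longrightarrow> x \<le> zz (j + i) \<and> x \<le> zz (j + Suc i)"
      using lk n jk by (auto simp: linked_def)
    then obtain p where p: "\<And>i. i \<le> n \<Longrightarrow> p i \<le> zz (j + i) \<and> p i \<le> zz (j + Suc i)"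
      by metis
    obtain q where q: "q \<le> zz j" "q \<le> zz k"
      using l by (auto simp: linked_def)
    have "inj_on (\<lambda>i. zz (j + i)) {..Suc n}"
    proof (rule inj_onI)
      fix x x'
      assume "x \<in> {..Suc n}" "x' \<in> {..Suc n}" "zz (j + x) = zz (j + x')"
      then show "x = x'"
        using inj_onD[OF inj, of "j + x" "j + x'"] n jk by simp
    qed
    then show False
    proof (rule no_cycle[OF n(1), where p = p and q = q])
      show "zz (j + i) \<in> max_points" if "i \<le> Suc n" for i
        using mx[of "j + i"] that n jk by simp
      show "p i \<le> zz (j + i)" "p i \<le> zz (j + Suc i)" if "i \<le> n" for i
        using p that by blast+
      show "q \<le> zz (j + 0)" "q \<le> zz (j + Suc n)"
        using q n by simp_all
    qed
  qed
  have inside: "k = Suc j \<or> j = Suc k" if "j \<le> m" "k \<le> m" "linked (zz j) (zz k)" for j k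
  proof (cases j k rule: linorder_cases)
    case less
    then show ?thesis using chord that by blast
  next
    case equal
    then show ?thesis using that by (simp add: linked_def)
  next
    case greater
    then show ?thesis using chord that linked_sym by blast
  qed
  \<comment> \<open>A neighbour off the path would lengthen the path if \<open>zz j\<close> is an
    end, and would be a third neighbour of \<open>zz j\<close> otherwise.\<close>
  have "y \<in> zz ` {..m}" if j: "j \<le> m" and y: "y \<in> Z" and l: "linked (zz j) y" for j y
  proof (rule ccontr)
    assume out: "y \<notin> zz ` {..m}"
    consider "j = m" | "j = 0" | "0 < j" "j < m" using j by linarith
    then show False
    proof cases
      case 1
      let ?z = "zz(Suc m := y)"
      have ne: "zz i \<noteq> y" if "i \<le> m" for i
        using out that by auto
      have "inj_on ?z {..Suc m}"
      proof (rule inj_onI)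
        fix a b assume "a \<in> {..Suc m}" "b \<in> {..Suc m}" "?z a = ?z b"
        then show "a = b"
          using ne[of a] ne[of b] inj_onD[OF inj, of a b] by (auto simp: le_Suc_eq split: if_splits)
      qed
      moreover have "?z ` {..Suc m} \<subseteq> Z"
        using sub y by (auto simp: le_Suc_eq)
      moreover have "linked (?z i) (?z (Suc i))" if "i < Suc m" for i
        using that lk[of i] l 1 by (auto simp: less_Suc_eq)
      ultimately have "path (Suc m) ?z"
        unfolding path_def by blast
      then show False using max[of "Suc m"] not_less_eq_eq[of m m] by blast
    next
      case 2
      let ?z = "case_nat y zz"
      have ne: "zz i \<noteq> y" if "i \<le> m" for i
        using out that by auto
      have "inj_on ?z {..Suc m}"
      proof (rule inj_onI)
        fix a b assume "a \<in> {..Suc m}" "b \<in> {..Suc m}" "?z a = ?z b"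
        then show "a = b"
          using ne[of "a - 1"] ne[of "b - 1"] inj_onD[OF inj, of "a - 1" "b - 1"]
          by (cases a; cases b; simp)
      qed
      moreover have "?z ` {..Suc m} \<subseteq> Z"
        using sub y by (force split: nat.splits)
      moreover have "linked (?z i) (?z (Suc i))" if "i < Suc m" for i
        using that lk[of "i - 1"] linked_sym[OF l] 2 by (cases i) auto
      ultimately have "path (Suc m) ?z"
        unfolding path_def by blast
      then show False using max[of "Suc m"] not_less_eq_eq[of m m] by blast
    next
      case 3
      then have "linked (zz j) (zz (j - 1))" "linked (zz j) (zz (Suc j))"
        using lk[of "j - 1"] lk[of j] linked_sym by auto
      moreover have "j - 1 \<le> m" "Suc j \<le> m"
        using 3 by auto
      moreover from this have "zz (j - 1) \<noteq> y" "zz (Suc j) \<noteq> y"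
        using out by auto
      ultimately have "zz (j - 1) = zz (Suc j)"
        using at_most_two_linked[of "zz j" "zz (j - 1)" "zz (Suc j)" y] l mx j y Z(1) by blast
      then have "j - 1 = Suc j"
        by (rule inj_onD[OF inj]) (use 3 in auto)
      then show False by simp
    qed
  qed
  then show thesis
    using that[OF inj sub lk] inside by blast
qed

end

section \<open>Vectors and functionals compatible with a family of subspaces\<close>

lemma vector_space_fun_scale:
  assumes "vector_space s"
  shows "vector_space (fun_scale s)"
proof -
  interpret vector_space s by fact
  show ?thesis
    by unfold_locales (auto simp: fun_scale_def fun_eq_iff scale_right_distrib scale_left_distrib)
qed

lemma fun_scale_apply: "fun_scale s c u z = s c (u z)"
  by (simp add: fun_scale_def)

definition width2 :: "'a set set \<Rightarrow> bool" where
  "width2 \<G> \<longleftrightarrow> (\<forall>A\<in>\<G>. \<forall>B\<in>\<G>. \<forall>C\<in>\<G>. A \<subseteq> B \<or> B \<subseteq> A \<or> A \<subseteq> C \<or> C \<subseteq> A \<or> B \<subseteq> C \<or> C \<subseteq> B)"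

text \<open>For a relation \<open>X \<subseteq> V\<^sub>y \<oplus> V\<^sub>z\<close>, this is the image of \<open>F \<subseteq> V\<^sub>y\<close> in \<open>V\<^sub>z\<close>.\<close>
definition transfer :: "('p \<Rightarrow> 'v) set \<Rightarrow> 'p \<Rightarrow> 'p \<Rightarrow> 'v set \<Rightarrow> 'v set" where
  "transfer X y z F = {u z |u. u \<in> X \<and> u y \<in> F}"

lemma transfer_mono: "F \<subseteq> G \<Longrightarrow> transfer X y z F \<subseteq> transfer X y z G"
  by (auto simp: transfer_def)

lemma obtain_minimal:
  fixes A :: "'a set set"
  assumes "finite A" and ex: "G \<in> A" "P G"
  obtains D where "D \<in> A" "P D" "\<And>G. G \<in> A \<Longrightarrow> P G \<Longrightarrow> G \<subseteq> D \<Longrightarrow> G = D"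
proof -
  have "\<exists>D\<in>{G \<in> A. P G}. \<forall>G\<in>{G \<in> A. P G}. G \<le> D \<longrightarrow> D = G"
    using assms by (intro finite_has_minimal) auto
  then obtain D where D: "D \<in> A" "P D" "\<forall>G\<in>{G \<in> A. P G}. G \<le> D \<longrightarrow> D = G"
    by blast
  show thesis
    by (rule that[OF D(1,2)]) (use D(3) in auto)
qed

locale scalar_space = vector_space s
  for s :: "'k::field \<Rightarrow> 'v::ab_group_add \<Rightarrow> 'v"
begin

section \<open>Linear functionals and nested subspaces\<close>

definition functional :: "('v \<Rightarrow> 'k) \<Rightarrow> bool" where
  "functional h \<longleftrightarrow> (\<forall>u v. h (u + v) = h u + h v) \<and> (\<forall>c v. h (s c v) = c * h v)"

lemma functional_add: "functional h \<Longrightarrow> h (u + v) = h u + h v"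
  by (auto simp: functional_def)

lemma functional_scale: "functional h \<Longrightarrow> h (s c v) = c * h v"
  by (auto simp: functional_def)

lemma functional_0: "functional h \<Longrightarrow> h 0 = 0"
  using functional_scale[of h 0 0] by simp

lemma functional_diff: "functional h \<Longrightarrow> h (u - v) = h u - h v"
  using functional_add[of h u "- v"] functional_scale[of h "- 1" v] by simp

text \<open>A basis of \<open>W\<close> together with \<open>v\<close> extends to a basis of the
  whole space; \<open>h\<close> is the coordinate at \<open>v\<close>.\<close>

lemma separating_functional:
  assumes W: "subspace W" and v: "v \<notin> W"
  obtains h where "functional h" "h v = 1" "\<And>w. w \<in> W \<Longrightarrow> h w = 0"
proof -
  obtain B where B: "B \<subseteq> W" "independent B" "W \<subseteq> span B"
    using maximal_independent_subset by metis
  then have span: "span B = W"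
    using W by (simp add: span_subspace)
  then have ind: "independent (insert v B)" and "v \<notin> B"
    using B v by (auto simp: independent_insert span_base)
  define C where "C = extend_basis (insert v B)"
  have C: "independent C" "span C = UNIV" "insert v B \<subseteq> C"
    using ind extend_basis_superset[OF ind] by (simp_all add: C_def independent_extend_basis span_extend_basis)
  define h where "h u = representation C u v" for u
  show thesis
  proof
    show "functional h"
      using C by (simp add: functional_def h_def representation_add representation_scale)
    show "h v = 1"
      using C by (simp add: h_def representation_basis)
    show "h w = 0" if "w \<in> W" for w
    proof -
      have "representation C w = representation B w"
        using C that span by (intro representation_extend) auto
      then show ?thesis
        using representation_ne_zero[of B w v] \<open>v \<notin> B\<close> by (auto simp: h_def)
    qed
  qed
qed

text \<open>Inserting \<open>0\<close> covers the empty chain, whose union is empty.\<close>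

lemma subspace_chain_Union:
  assumes sub: "\<And>F. F \<in> \<C> \<Longrightarrow> subspace F"
    and chain: "\<And>F G. F \<in> \<C> \<Longrightarrow> G \<in> \<C> \<Longrightarrow> F \<subseteq> G \<or> G \<subseteq> F"
  shows "subspace (insert 0 (\<Union>\<C>))"
proof (rule subspaceI)
  fix u v assume uv: "u \<in> insert 0 (\<Union>\<C>)" "v \<in> insert 0 (\<Union>\<C>)"
  show "u + v \<in> insert 0 (\<Union>\<C>)"
  proof (cases "u = 0 \<or> v = 0")
    case False
    then obtain F G where FG: "F \<in> \<C>" "G \<in> \<C>" "u \<in> F" "v \<in> G"
      using uv by auto
    then have "u + v \<in> F \<or> u + v \<in> G"
      using chain[OF FG(1,2)] sub subspace_add by blast
    then show ?thesis
      using FG by auto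
  qed (use uv in auto)
next
  fix c u assume "u \<in> insert 0 (\<Union>\<C>)"
  then show "s c u \<in> insert 0 (\<Union>\<C>)"
  proof (cases "u = 0")
    case False
    then obtain F where "F \<in> \<C>" "u \<in> F"
      using \<open>u \<in> _\<close> by auto
    then show ?thesis
      using sub subspace_scale by blast
  qed simp
qed auto

text \<open>Take a minimal nonzero member \<open>C\<close> and a nonzero \<open>v \<in> C\<close>,
  so that every member containing \<open>C\<close> contains \<open>v\<close>. The other nonzero
  members are not contained in \<open>C\<close>, by minimality, so width two makes them a chain;
  those missing \<open>v\<close> unite to a subspace on which a functional with
  \<open>h v = 1\<close> can vanish.\<close>

lemma thin_vector_exists:
  assumes fin: "finite \<G>" and sub: "\<And>G. G \<in> \<G> \<Longrightarrow> subspace G" and w: "width2 \<G>"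
    and V: "V \<in> \<G>" "V \<noteq> {0}" "\<And>G. G \<in> \<G> \<Longrightarrow> G \<subseteq> V"
  obtains v h where "v \<in> V" "functional h" "h v = 1" "\<And>G. G \<in> \<G> \<Longrightarrow> v \<in> G \<or> (\<forall>g\<in>G. h g = 0)"
proof -
  obtain C where C: "C \<in> \<G>" "C \<noteq> {0}" and C_min: "\<And>G. G \<in> \<G> \<Longrightarrow> G \<noteq> {0} \<Longrightarrow> G \<subseteq> C \<Longrightarrow> G = C"
    using obtain_minimal[of \<G> V "\<lambda>G. G \<noteq> {0}"] fin V(1,2) by blast
  define \<I> where "\<I> = {G \<in> \<G>. \<not> C \<subseteq> G \<and> G \<noteq> {0}}"
  have chain: "F \<subseteq> G \<or> G \<subseteq> F" if "F \<in> \<I>" "G \<in> \<I>" for F G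
  proof -
    have "\<not> F \<subseteq> C" "\<not> G \<subseteq> C"
      using that C_min by (auto simp: \<I>_def)
    then show ?thesis
      using w C that unfolding width2_def \<I>_def by blast
  qed
  have zero: "0 \<in> G" if "G \<in> \<G>" for G
    using sub[OF that] subspace_0 by auto
  \<comment> \<open>If some member of the chain \<open>\<I>\<close> meets \<open>C\<close>
    nontrivially, \<open>v\<close> is taken from the smallest such member, hence lies in all of
    them.\<close>
  obtain v where v: "v \<in> C" "v \<noteq> 0" and v_min: "\<And>G. G \<in> \<I> \<Longrightarrow> v \<in> G \<or> G \<inter> C = {0}"
  proof (cases "\<exists>G\<in>\<I>. G \<inter> C \<noteq> {0}")
    case True
    then obtain G where "G \<in> \<I>" "G \<inter> C \<noteq> {0}" by blast
    moreover have "finite \<I>"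
      using fin by (auto simp: \<I>_def)
    ultimately obtain D where D: "D \<in> \<I>" "D \<inter> C \<noteq> {0}"
      and D_min: "\<And>G. G \<in> \<I> \<Longrightarrow> G \<inter> C \<noteq> {0} \<Longrightarrow> G \<subseteq> D \<Longrightarrow> G = D"
      using obtain_minimal[of \<I> G "\<lambda>G. G \<inter> C \<noteq> {0}"] by blast
    have "0 \<in> D \<inter> C"
      using zero C D by (auto simp: \<I>_def)
    then obtain v where v: "v \<in> D \<inter> C" "v \<noteq> 0"
      using D by blast
    have "v \<in> G \<or> G \<inter> C = {0}" if "G \<in> \<I>" for G
      using chain[OF that D(1)] D_min[OF that] v by auto
    then show thesis
      using that v by blast
  next
    case False
    obtain v where "v \<in> C" "v \<noteq> 0"
      using C zero by blast
    then show thesis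
      using that False by blast
  qed
  let ?W = "insert 0 (\<Union>{G \<in> \<I>. v \<notin> G})"
  have "subspace ?W"
    by (rule subspace_chain_Union) (use chain sub in \<open>auto simp: \<I>_def\<close>)
  moreover have "v \<notin> ?W"
    using v by auto
  ultimately obtain h where h: "functional h" "h v = 1" "\<And>w. w \<in> ?W \<Longrightarrow> h w = 0"
    using separating_functional by blast
  have "v \<in> G \<or> (\<forall>g\<in>G. h g = 0)" if "G \<in> \<G>" for G
  proof (cases "G \<in> \<I>")
    case True
    then show ?thesis using h(3) by blast
  next
    case False
    then show ?thesis
      using that v h(3) by (auto simp: \<I>_def)
  qed
  then show thesis
    using that[OF _ h(1,2)] v(1) V(3)[OF C(1)] by blast
qed

section \<open>Linear relations and lifting through them\<close>

lemma subspace_eval: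
  assumes "module.subspace (fun_scale s) X"
  shows "subspace ((\<lambda>u. u z) ` X)"
proof -
  interpret F: vector_space "fun_scale s"
    by (rule vector_space_fun_scale) (rule vector_space_axioms)
  show ?thesis
  proof (rule subspaceI)
    show "0 \<in> (\<lambda>u. u z) ` X"
      using F.subspace_0[OF assms] by (force simp: zero_fun_def)
    fix a b assume "a \<in> (\<lambda>u. u z) ` X" "b \<in> (\<lambda>u. u z) ` X"
    then show "a + b \<in> (\<lambda>u. u z) ` X"
      using F.subspace_add[OF assms] by (force simp: plus_fun_def)
  next
    fix c a assume "a \<in> (\<lambda>u. u z) ` X"
    then show "s c a \<in> (\<lambda>u. u z) ` X"
      using F.subspace_scale[OF assms] by (force simp: fun_scale_def)
  qed
qed

lemma subspace_transfer:
  assumes X: "module.subspace (fun_scale s) X" and F: "subspace F"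
  shows "subspace (transfer X y z F)"
proof -
  interpret F: vector_space "fun_scale s"
    by (rule vector_space_fun_scale) (rule vector_space_axioms)
  have "F.subspace {u \<in> X. u y \<in> F}"
    using X F F.subspace_0[OF X]
    by (intro F.subspaceI) (auto simp: F.subspace_add F.subspace_scale subspace_add subspace_scale subspace_0
        fun_scale_apply)
  moreover have "transfer X y z F = (\<lambda>u. u z) ` {u \<in> X. u y \<in> F}"
    by (auto simp: transfer_def)
  ultimately show ?thesis
    using subspace_eval by simp
qed

text \<open>
  Of all \<open>w \<in> X\<close> over the given \<open>v\<close>, take one whose other component lies in the smallest possible
  member of the chain; then \<open>h\<close> induces the wanted functional on the domain of \<open>X\<close>.
\<close>
lemma thin_vector_lift:
  fixes X :: "('p \<Rightarrow> 'v) set"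
  assumes X: "module.subspace (fun_scale s) X"
    and fin: "finite \<C>" and sub: "\<And>F. F \<in> \<C> \<Longrightarrow> subspace F"
    and chain: "\<And>F G. F \<in> \<C> \<Longrightarrow> G \<in> \<C> \<Longrightarrow> F \<subseteq> G \<or> G \<subseteq> F"
    and v: "v \<in> (\<lambda>u. u z) ` X" and h: "functional h" "h v = 1"
    and h0: "\<And>u. u \<in> X \<Longrightarrow> u y = 0 \<Longrightarrow> h (u z) = 0"
    and thin: "\<And>F. F \<in> \<C> \<Longrightarrow> v \<in> transfer X y z F \<or> (\<forall>a\<in>transfer X y z F. h a = 0)"
  obtains w g where "w \<in> X" "w z = v" "functional g" "g (w y) = 1" "\<And>u. u \<in> X \<Longrightarrow> g (u y) = h (u z)"
    "\<And>F. F \<in> \<C> \<Longrightarrow> w y \<in> F \<or> (\<forall>a\<in>F. g a = 0)"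
proof -
  interpret F: vector_space "fun_scale s"
    by (rule vector_space_fun_scale) (rule vector_space_axioms)
  \<comment> \<open>The members of the chain that contain the \<open>y\<close>-component of some
    lift of \<open>v\<close>. They are nested, so a lift through the smallest serves all of
    them.\<close>
  define \<D> where "\<D> = {F \<in> \<C>. v \<in> transfer X y z F}"
  obtain w where w: "w \<in> X" "w z = v" and w_min: "\<And>F. F \<in> \<D> \<Longrightarrow> w y \<in> F"
  proof (cases "\<D> = {}")
    case True
    then show thesis using that v by auto
  next
    case False
    then obtain G where G: "G \<in> \<D>" by blast
    have "finite \<D>"
      using fin by (auto simp: \<D>_def)
    from obtain_minimal[OF this G TrueI]
    obtain D where D: "D \<in> \<D>" "\<And>F. F \<in> \<D> \<Longrightarrow> F \<subseteq> D \<Longrightarrow> F = D"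
      by auto
    have "D \<subseteq> F" if "F \<in> \<D>" for F
      using D(2)[OF that] chain[of D F] D(1) that by (auto simp: \<D>_def)
    moreover obtain w where "w \<in> X" "w z = v" "w y \<in> D"
      using D(1) by (auto simp: \<D>_def transfer_def)
    ultimately show thesis using that by blast
  qed
  \<comment> \<open>The functional \<open>g\<close> has to kill all remaining members;
    \<open>h_Z\<close> shows that this is consistent with \<open>h\<close>.\<close>
  let ?Z = "insert 0 (\<Union>(\<C> - \<D>))"
  have Z: "subspace ?Z"
    by (rule subspace_chain_Union) (use chain sub in auto)
  have h_Z: "h (u z) = 0" if "u \<in> X" "u y \<in> ?Z" for u
    using that h0 thin by (fastforce simp: \<D>_def transfer_def)
  \<comment> \<open>Killing \<open>?K\<close> is what forces \<open>g (u y)\<close> to depend on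
    \<open>h (u z)\<close> only.\<close>
  let ?K = "(\<lambda>u. u y) ` {u \<in> X. h (u z) = 0}"
  have "F.subspace {u \<in> X. h (u z) = 0}"
    using X F.subspace_0[OF X] h
    by (intro F.subspaceI) (auto simp: F.subspace_add F.subspace_scale functional_add functional_scale functional_0
        fun_scale_apply)
  then have K: "subspace ?K"
    by (rule subspace_eval)
  let ?W = "{a + b |a b. a \<in> ?Z \<and> b \<in> ?K}"
  have "subspace ?W"
    using subspace_sums[OF Z K] .
  \<comment> \<open>Otherwise \<open>w - u\<close> is an element of \<open>X\<close> with
    \<open>y\<close>-component in \<open>?Z\<close>, so \<open>h\<close> vanishes on its
    \<open>z\<close>-component; but the value there is 1.\<close>
  moreover have "w y \<notin> ?W"
  proof
    assume "w y \<in> ?W"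
    then obtain a u where u: "w y = a + u y" "a \<in> ?Z" "u \<in> X" "h (u z) = 0"
      by auto
    have "h ((w - u) z) = 0"
    proof (rule h_Z)
      show "w - u \<in> X"
        using F.subspace_diff X w u by blast
      show "(w - u) y \<in> ?Z"
        using u by simp
    qed
    then show False
      using h u w by (simp add: functional_diff)
  qed
  ultimately obtain g where g: "functional g" "g (w y) = 1" "\<And>a. a \<in> ?W \<Longrightarrow> g a = 0"
    using separating_functional by blast
  have g_Z: "g a = 0" if "a \<in> ?Z" for a
  proof -
    have "0 \<in> ?K" using K subspace_0 by blast
    then have "a + 0 \<in> ?W" using that by blast
    then show ?thesis using g(3)[of a] by simp
  qed
  have g_K: "g a = 0" if "a \<in> ?K" for a
  proof -
    have "0 + a \<in> ?W" using that by blast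
    then show ?thesis using g(3)[of a] by simp
  qed
  show thesis
  proof
    show "w \<in> X" "w z = v" "functional g" "g (w y) = 1" by fact+
    show "g (u y) = h (u z)" if u: "u \<in> X" for u
    proof -
      let ?u = "u - fun_scale s (h (u z)) w"
      have "?u \<in> X"
        using u w X F.subspace_diff F.subspace_scale by blast
      moreover have "h (?u z) = 0"
        using h w by (simp add: fun_scale_apply functional_diff functional_scale)
      ultimately have "g (?u y) = 0"
        by (intro g_K) blast
      then show ?thesis
        using g by (simp add: fun_scale_apply functional_diff functional_scale)
    qed
    show "w y \<in> F \<or> (\<forall>a\<in>F. g a = 0)" if "F \<in> \<C>" for F
      using that w_min g_Z by blast
  qed
qed

end

section \<open>Idempotent endomorphisms of peak spaces\<close>

text \<open>The analogue of \<open>sum_map\<close> without the reset to 0 off the peaks. The two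
  agree on every \<open>U x\<close> for linear \<open>f z\<close>, because elements of
  \<open>U x\<close> vanish off the peaks.\<close>

definition peak_endo :: "('p \<Rightarrow> 'v \<Rightarrow> 'v) \<Rightarrow> ('p \<Rightarrow> 'v) \<Rightarrow> 'p \<Rightarrow> 'v" where
  "peak_endo f u = (\<lambda>z. f z (u z))"

lemma peak_endo_apply: "peak_endo f u z = f z (u z)"
  by (simp add: peak_endo_def)

locale peak_space_locale = scalar_space s
  for s :: "'k::field \<Rightarrow> 'v::ab_group_add \<Rightarrow> 'v" +
  fixes U :: "'p::{finite, order} \<Rightarrow> ('p \<Rightarrow> 'v) set"
  assumes peak_space: "peak_space s U"
begin

sublocale F: vector_space "fun_scale s"
  by (rule vector_space_fun_scale) (rule vector_space_axioms)

lemma fin_dim_U: "fin_dim_subspace (fun_scale s) (U x)"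
  using peak_space by (simp add: peak_space_def)

lemma subspace_U: "F.subspace (U x)"
  using fin_dim_U by (simp add: fin_dim_subspace_def)

lemma U_ambient: "u \<in> U x \<Longrightarrow> u \<in> ambient U"
  using peak_space unfolding peak_space_def by blast

lemma U_max_points: "u \<in> U x \<Longrightarrow> z \<notin> max_points \<Longrightarrow> u z = 0"
  by (drule U_ambient) (simp add: ambient_def max_sum_def split: if_splits)

lemma U_at_point: "u \<in> U x \<Longrightarrow> z \<in> max_points \<Longrightarrow> at_point z (u z) \<in> U z"
  by (drule U_ambient) (simp add: ambient_def max_sum_def summand_def split: if_splits)

lemma U_zero:
  assumes "u \<in> U x" "\<not> x \<le> z"
  shows "u z = 0"
proof (cases "z \<in> max_points")
  case True
  then have "projection z u \<in> {0}"
    using peak_space assms unfolding peak_space_def by blast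
  then have "projection z u z = 0"
    by (simp add: zero_fun_def)
  then show ?thesis
    by (simp add: projection_def)
qed (use assms U_max_points in blast)

lemma U_projection: "u \<in> U x \<Longrightarrow> x \<le> y \<Longrightarrow> projection y u \<in> U y"
  using peak_space unfolding peak_space_def by blast

lemma U_max:
  assumes "z \<in> max_points" "u \<in> U z"
  shows "u = at_point z (u z)"
proof -
  have "u \<in> at_point z ` summand U z"
    using peak_space assms unfolding peak_space_def by blast
  then show ?thesis
    by (auto simp: at_point_def)
qed

lemma subspace_summand: "subspace (summand U z)"
proof (rule subspaceI)
  have "at_point z (0 :: 'v) = 0"
    by (auto simp: at_point_def)
  then show "0 \<in> summand U z"
    using F.subspace_0[OF subspace_U[of z]] by (simp add: summand_def)
next
  fix a b assume "a \<in> summand U z" "b \<in> summand U z"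
  moreover have "at_point z (a + b) = at_point z a + at_point z b"
    by (auto simp: at_point_def)
  ultimately show "a + b \<in> summand U z"
    using F.subspace_add[OF subspace_U[of z]] by (simp add: summand_def)
next
  fix c a assume "a \<in> summand U z"
  moreover have "at_point z (s c a) = fun_scale s c (at_point z a)"
    by (auto simp: at_point_def fun_scale_def)
  ultimately show "s c a \<in> summand U z"
    using F.subspace_scale[OF subspace_U[of z]] by (simp add: summand_def)
qed

section \<open>Direct summands cut out by idempotents\<close>

definition linear_family :: "('p \<Rightarrow> 'v \<Rightarrow> 'v) \<Rightarrow> bool" where
  "linear_family f \<longleftrightarrow> (\<forall>z a b. f z (a + b) = f z a + f z b) \<and> (\<forall>z c a. f z (s c a) = s c (f z a))"

lemma linear_family_0: "linear_family f \<Longrightarrow> f z 0 = 0"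
  unfolding linear_family_def by (metis scale_zero_left)

lemma linear_family_diff: "linear_family f \<Longrightarrow> f z (a - b) = f z a - f z b"
  unfolding linear_family_def by (metis add_diff_cancel diff_add_cancel)

lemma peak_endo_at_point: "linear_family f \<Longrightarrow> peak_endo f (at_point z v) = at_point z (f z v)"
  by (auto simp: peak_endo_def at_point_def linear_family_0)

lemma peak_endo_projection: "linear_family f \<Longrightarrow> peak_endo f (projection z u) = projection z (peak_endo f u)"
  by (auto simp: peak_endo_def projection_def linear_family_0)

lemma module_hom_peak_endo:
  assumes "linear_family f"
  shows "module_hom (fun_scale s) (fun_scale s) (peak_endo f)"
  using assms by unfold_locales (auto simp: peak_endo_def fun_scale_def linear_family_def)

text \<open>A linear family commutes with \<open>projection\<close> and \<open>at_point\<close>, so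
  the defining conditions pass from \<open>U\<close> to the image; invariance keeps the image at a
  peak supported at that peak. The lemma serves both an idempotent and its complement.\<close>

lemma peak_space_image:
  assumes f: "linear_family f" and inv: "\<And>x. peak_endo f ` U x \<subseteq> U x"
  shows "peak_space s (\<lambda>x. peak_endo f ` U x)"
proof -
  let ?e = "peak_endo f"
  interpret e: module_hom "fun_scale s" "fun_scale s" ?e
    using f by (rule module_hom_peak_endo)
  have summand: "v \<in> summand (\<lambda>x. ?e ` U x) z" if "at_point z v \<in> ?e ` U z" for v z
    using that by (simp add: summand_def)
  have 1: "fin_dim_subspace (fun_scale s) (?e ` U x)" for x
  proof -
    obtain B where "finite B" "F.span B = U x"
      using fin_dim_U[of x] by (auto simp: fin_dim_subspace_def)
    then have "finite (?e ` B)" "F.span (?e ` B) = ?e ` U x"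
      using e.span_image by auto
    moreover have "F.subspace (?e ` U x)"
      using e.subspace_image[OF subspace_U] .
    ultimately show ?thesis
      by (auto simp: fin_dim_subspace_def)
  qed
  have 2: "?e ` U z = at_point z ` summand (\<lambda>x. ?e ` U x) z" if z: "z \<in> max_points" for z
  proof
    show "?e ` U z \<subseteq> at_point z ` summand (\<lambda>x. ?e ` U x) z"
    proof
      fix t assume t: "t \<in> ?e ` U z"
      then have "t = at_point z (t z)"
        using inv[of z] U_max[OF z] by blast
      with t have "t z \<in> summand (\<lambda>x. ?e ` U x) z"
        by (intro summand) simp
      with \<open>t = _\<close> show "t \<in> at_point z ` summand (\<lambda>x. ?e ` U x) z"
        by blast
    qed
  qed (auto simp: summand_def)
  have 3: "?e ` U x \<subseteq> ambient (\<lambda>x. ?e ` U x)" for x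
  proof
    fix t assume "t \<in> ?e ` U x"
    then obtain u where u: "u \<in> U x" "t = ?e u" by blast
    have "t z \<in> summand (\<lambda>x. ?e ` U x) z" if "z \<in> max_points" for z
    proof (rule summand)
      have "at_point z (t z) = ?e (at_point z (u z))"
        using u f by (simp add: peak_endo_at_point peak_endo_apply)
      then show "at_point z (t z) \<in> ?e ` U z"
        using U_at_point[OF u(1) that] by blast
    qed
    moreover have "t z = 0" if "z \<notin> max_points" for z
      using U_max_points[OF u(1) that] u(2) f by (simp add: peak_endo_apply linear_family_0)
    ultimately show "t \<in> ambient (\<lambda>x. ?e ` U x)"
      by (simp add: ambient_def max_sum_def)
  qed
  have 4: "projection z ` ?e ` U x = {0}" if "z \<in> max_points" "\<not> x \<le> z" for x z
  proof -
    have "projection z ` ?e ` U x = ?e ` projection z ` U x"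
      using peak_endo_projection[OF f] by (simp add: image_image)
    also have "projection z ` U x = {0}"
      using peak_space that by (auto simp: peak_space_def)
    finally show ?thesis
      using e.zero by (simp only: image_insert image_empty)
  qed
  have 5: "projection y ` ?e ` U x \<subseteq> ?e ` U y" if "x \<le> y" for x y
  proof -
    have "projection y ` ?e ` U x = ?e ` projection y ` U x"
      using peak_endo_projection[OF f] by (simp add: image_image)
    then show ?thesis
      using U_projection that by auto
  qed
  show ?thesis
    unfolding peak_space_def by (intro conjI allI ballI impI) (rule 1 2 3 4 5 | assumption)+
qed

text \<open>\<open>f\<close> and \<open>g\<close> are complementary idempotents, so
  \<open>v \<mapsto> (f z v, g z v)\<close> is an isomorphism with inverse
  \<open>(a, b) \<mapsto> a + b\<close>.\<close>

lemma peak_isomorphic_direct_sum: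
  assumes f: "linear_family f" and idem: "\<And>z v. f z (f z v) = f z v"
    and inv: "\<And>x. peak_endo f ` U x \<subseteq> U x"
  defines "g \<equiv> \<lambda>z v. v - f z v"
  shows "peak_isomorphic s (module_prod.scale s s) U
    (peak_direct_sum (\<lambda>x. peak_endo f ` U x) (\<lambda>x. peak_endo g ` U x))"
proof -
  interpret P: vector_space_prod s s ..
  let ?S = "peak_direct_sum (\<lambda>x. peak_endo f ` U x) (\<lambda>x. peak_endo g ` U x)"
  let ?h = "\<lambda>z v. (f z v, g z v)"
  have g: "linear_family g"
    using f by (auto simp: linear_family_def g_def scale_right_diff_distrib)
  have fg: "f z (g z v) = 0" "g z (f z v) = 0" "g z (g z v) = g z v" "f z v + g z v = v" for z v
    using f idem by (auto simp: g_def linear_family_diff linear_family_0)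
  have inv_g: "peak_endo g u \<in> U x" if "u \<in> U x" for u x
  proof -
    have "peak_endo g u = u - peak_endo f u"
      by (auto simp: peak_endo_def g_def)
    then show ?thesis
      using F.subspace_diff[OF subspace_U[of x] that, of "peak_endo f u"] inv that
      by (metis image_subset_iff)
  qed
  have inv_f: "peak_endo f u \<in> U x" if "u \<in> U x" for u x
    using inv that by blast
  have sum_map_U: "sum_map ?h u = (\<lambda>z. (peak_endo f u z, peak_endo g u z))" if "u \<in> U x" for u x
    using U_max_points[OF that] f g by (auto simp: sum_map_def peak_endo_def linear_family_0 zero_prod_def)
  have img: "sum_map ?h ` U x = ?S x" for x
  proof
    show "sum_map ?h ` U x \<subseteq> ?S x"
      by (auto simp: peak_direct_sum_def sum_map_U)
    show "?S x \<subseteq> sum_map ?h ` U x"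
    proof
      fix t assume "t \<in> ?S x"
      then obtain u w where uw: "u \<in> U x" "w \<in> U x" "t = (\<lambda>z. (peak_endo f u z, peak_endo g w z))"
        by (auto simp: peak_direct_sum_def)
      \<comment> \<open>\<open>u\<close> and \<open>w\<close> are unrelated elements of
        \<open>U x\<close>; since \<open>f\<close> and \<open>g\<close> annihilate each other,
        \<open>?r\<close> is a preimage of the pair.\<close>
      let ?r = "peak_endo f u + peak_endo g w"
      have r: "?r \<in> U x"
        using F.subspace_add[OF subspace_U[of x]] inv_f inv_g uw by blast
      have "peak_endo f ?r = peak_endo f u" "peak_endo g ?r = peak_endo g w"
        using f g idem fg by (auto simp: peak_endo_def linear_family_def)
      then have "sum_map ?h ?r = t"
        using sum_map_U[OF r] uw by simp
      with r show "t \<in> sum_map ?h ` U x" by blast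
    qed
  qed
  have summand_S: "?h z v \<in> summand ?S z" if "v \<in> summand U z" for z v
  proof -
    have at: "at_point z (?h z v) = (\<lambda>y. (peak_endo f (at_point z v) y, peak_endo g (at_point z v) y))"
      by (rule ext) (simp add: peak_endo_apply at_point_def linear_family_0[OF f] linear_family_0[OF g] zero_prod_def)
    have "at_point z v \<in> U z"
      using that by (simp add: summand_def)
    then have "at_point z (?h z v) \<in> ?S z"
      unfolding at peak_direct_sum_def by blast
    then show ?thesis
      by (simp add: summand_def)
  qed
  have summand_S': "a + b \<in> summand U z \<and> f z (a + b) = a \<and> g z (a + b) = b"
    if ab: "(a, b) \<in> summand ?S z" and z: "z \<in> max_points" for a b z
  proof -
    obtain u w where uw: "u \<in> U z" "w \<in> U z"
      and eq: "at_point z (a, b) = (\<lambda>y. (peak_endo f u y, peak_endo g w y))"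
      using ab by (auto simp: summand_def peak_direct_sum_def)
    have "a = f z (u z)" "b = g z (w z)"
      using fun_cong[OF eq, of z] by (auto simp: at_point_def peak_endo_def)
    moreover have "f z (u z) \<in> summand U z" "g z (w z) \<in> summand U z"
      using U_at_point[OF inv_f[OF uw(1)] z] U_at_point[OF inv_g[OF uw(2)] z]
      by (auto simp: summand_def peak_endo_apply)
    ultimately show ?thesis
      using subspace_add[OF subspace_summand] f g idem fg by (auto simp: linear_family_def)
  qed
  have "peak_morphism s P.scale U ?S ?h"
    unfolding peak_morphism_def linear_map_on_def
    using f g summand_S img by (auto simp: linear_family_def P.scale_prod)
  moreover have "bij_betw (sum_map ?h) (ambient U) (ambient ?S)"
  proof (rule bij_betw_byWitness[where f' = "\<lambda>t z. fst (t z) + snd (t z)"])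
    show "sum_map ?h ` ambient U \<subseteq> ambient ?S"
      using summand_S by (auto simp: ambient_def max_sum_def sum_map_def)
    show "(\<lambda>t z. fst (t z) + snd (t z)) ` ambient ?S \<subseteq> ambient U"
    proof (rule image_subsetI)
      fix t assume t: "t \<in> ambient ?S"
      have "fst (t z) + snd (t z) \<in> summand U z" if "z \<in> max_points" for z
        using t that summand_S'[of "fst (t z)" "snd (t z)" z]
        by (auto simp: ambient_def max_sum_def dest: spec[of _ z])
      then show "(\<lambda>z. fst (t z) + snd (t z)) \<in> ambient U"
        using t by (auto simp: ambient_def max_sum_def)
    qed
  next
    show "\<forall>u\<in>ambient U. (\<lambda>z. fst (sum_map ?h u z) + snd (sum_map ?h u z)) = u"
      using fg by (auto simp: ambient_def max_sum_def sum_map_def)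
  next
    show "\<forall>t\<in>ambient ?S. sum_map ?h (\<lambda>z. fst (t z) + snd (t z)) = t"
    proof (intro ballI ext)
      fix t z assume t: "t \<in> ambient ?S"
      show "sum_map ?h (\<lambda>z. fst (t z) + snd (t z)) z = t z"
      proof (cases "z \<in> max_points")
        case True
        then have "(fst (t z), snd (t z)) \<in> summand ?S z"
          using t by (auto simp: ambient_def max_sum_def dest: spec[of _ z])
        with True show ?thesis
          using summand_S' by (simp add: sum_map_def)
      qed (use t in \<open>auto simp: ambient_def max_sum_def sum_map_def\<close>)
    qed
  qed
  ultimately show ?thesis
    unfolding peak_isomorphic_def using img by blast
qed

text \<open>\<open>U\<close> splits into the images of \<open>f\<close> and of its complement. One
  of them is zero, and \<open>ne\<close> says that it is not the first.\<close>

lemma indecomposable_idempotent: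
  assumes ind: "indecomposable_peak_space s U"
    and f: "linear_family f" and idem: "\<And>z v. f z (f z v) = f z v"
    and inv: "\<And>x. peak_endo f ` U x \<subseteq> U x"
    and ne: "u \<in> U x" "peak_endo f u \<noteq> 0"
    and w: "w \<in> U y"
  shows "peak_endo f w = w"
proof -
  define g where "g = (\<lambda>z v. v - f z v)"
  have g: "linear_family g"
    using f by (auto simp: linear_family_def g_def scale_right_diff_distrib)
  have g_eq: "peak_endo g u = u - peak_endo f u" for u
    by (auto simp: peak_endo_def g_def)
  have inv_g: "peak_endo g ` U x \<subseteq> U x" for x
  proof (rule image_subsetI)
    fix u assume "u \<in> U x"
    then show "peak_endo g u \<in> U x"
      using F.subspace_diff[OF subspace_U[of x], of u "peak_endo f u"] inv unfolding g_eq by blast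
  qed
  have "zero_peak_space (\<lambda>x. peak_endo f ` U x) \<or> zero_peak_space (\<lambda>x. peak_endo g ` U x)"
    using ind peak_space_image[OF f inv] peak_space_image[OF g inv_g]
      peak_isomorphic_direct_sum[OF f idem inv, folded g_def]
    unfolding indecomposable_peak_space_def by blast
  moreover have "\<not> zero_peak_space (\<lambda>x. peak_endo f ` U x)"
    using ne unfolding zero_peak_space_def by blast
  ultimately have "zero_peak_space (\<lambda>x. peak_endo g ` U x)"
    by blast
  then have "w - peak_endo f w = 0"
    using w unfolding zero_peak_space_def g_eq by blast
  then show ?thesis
    by (metis right_minus_eq)
qed

end

section \<open>Thin strings\<close>

text \<open>Triples are sorted by how many members come from the chain \<open>\<L>\<close>: at least
  two, exactly one, or none.\<close>

lemma width2_Un: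
  assumes "\<And>A B. A \<in> \<L> \<Longrightarrow> B \<in> \<L> \<Longrightarrow> A \<subseteq> B \<or> B \<subseteq> A"
    and "\<And>A B C. A \<in> \<L> \<Longrightarrow> B \<in> \<E> \<Longrightarrow> C \<in> \<E> \<Longrightarrow> A \<subseteq> B \<or> A \<subseteq> C \<or> B \<subseteq> C \<or> C \<subseteq> B"
    and "width2 \<E>"
  shows "width2 (\<L> \<union> \<E>)"
  unfolding width2_def
proof (intro ballI)
  fix A B C
  assume "A \<in> \<L> \<union> \<E>" "B \<in> \<L> \<union> \<E>" "C \<in> \<L> \<union> \<E>"
  then show "A \<subseteq> B \<or> B \<subseteq> A \<or> A \<subseteq> C \<or> C \<subseteq> A \<or> B \<subseteq> C \<or> C \<subseteq> B"
    using assms(1)[of A B] assms(1)[of A C] assms(1)[of B C] assms(2)[of A B C] assms(2)[of B A C] assms(2)[of C A B]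
      assms(3)[unfolded width2_def, rule_format, of A B C]
    by (elim UnE) argo+
qed

context peak_space_locale
begin

section \<open>Support and coordinate subspaces\<close>

definition support :: "'p set" where
  "support = {z \<in> max_points. U z \<noteq> {0}}"

definition values_at :: "'p \<Rightarrow> 'p \<Rightarrow> 'v set" where
  "values_at x z = (\<lambda>u. u z) ` U x"

lemma values_atI: "u \<in> U x \<Longrightarrow> u z \<in> values_at x z"
  by (simp add: values_at_def)

lemma subspace_values_at: "subspace (values_at x z)"
  unfolding values_at_def by (rule subspace_eval) (rule subspace_U)

lemma values_at_mono:
  assumes "x \<le> y" "y \<le> z"
  shows "values_at x z \<subseteq> values_at y z"
  unfolding values_at_def
proof (rule image_subsetI)
  fix u assume "u \<in> U x"
  then have "projection y u \<in> U y"
    using assms(1) by (rule U_projection)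
  moreover have "u z = projection y u z"
    using assms(2) by (simp add: projection_def)
  ultimately show "u z \<in> (\<lambda>u. u z) ` U y"
    by blast
qed

lemma U_summand: "u \<in> U x \<Longrightarrow> z \<in> max_points \<Longrightarrow> u z \<in> summand U z"
  using U_at_point by (simp add: summand_def)

lemma values_at_summand: "z \<in> max_points \<Longrightarrow> values_at x z \<subseteq> summand U z"
  unfolding values_at_def by (rule image_subsetI) (rule U_summand)

lemma values_at_self: "z \<in> max_points \<Longrightarrow> values_at z z = summand U z"
proof
  show "summand U z \<subseteq> values_at z z"
  proof
    fix v assume "v \<in> summand U z"
    then show "v \<in> values_at z z"
      using values_atI[of "at_point z v" z z] by (simp add: summand_def at_point_def)
  qed
qed (rule values_at_summand)

lemma U_support:
  assumes "u \<in> U x" "u z \<noteq> 0"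
  shows "z \<in> support" "x \<le> z"
proof -
  show "x \<le> z"
    using U_zero assms by blast
  have z: "z \<in> max_points"
    using U_max_points assms by blast
  have "at_point z (u z) \<noteq> 0"
    using assms(2) by (auto simp: at_point_def fun_eq_iff)
  then show "z \<in> support"
    using z U_at_point[OF assms(1) z] unfolding support_def by blast
qed

end

text \<open>By \<open>zz_component\<close> the path is a whole component of the link graph on the
  support, without chords.\<close>

locale peak_string = peak_space_locale s U + type_A_poset "TYPE('p)"
  for s :: "'k::field \<Rightarrow> 'v::ab_group_add \<Rightarrow> 'v"
    and U :: "'p::{finite, order} \<Rightarrow> ('p \<Rightarrow> 'v) set" +
  fixes m :: nat and zz :: "nat \<Rightarrow> 'p"
  assumes zz_inj: "inj_on zz {..m}"
    and zz_support: "\<And>j. j \<le> m \<Longrightarrow> zz j \<in> support"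
    and zz_linked: "\<And>j. j < m \<Longrightarrow> linked (zz j) (zz (Suc j))"
    and zz_component: "\<And>j y. j \<le> m \<Longrightarrow> y \<in> support \<Longrightarrow> linked (zz j) y \<Longrightarrow>
      \<exists>k\<le>m. y = zz k \<and> (k = Suc j \<or> j = Suc k)"
begin

section \<open>Position of the links in the poset\<close>

lemma zz_max: "j \<le> m \<Longrightarrow> zz j \<in> max_points"
  using zz_support by (auto simp: support_def)

lemma zz_eq_iff: "j \<le> m \<Longrightarrow> k \<le> m \<Longrightarrow> zz j = zz k \<longleftrightarrow> j = k"
  using inj_on_eq_iff[OF zz_inj, of j k] by simp

text \<open>Unspecified for \<open>j \<ge> m\<close>.\<close>
definition link :: "nat \<Rightarrow> 'p" where
  "link j = (SOME x. x \<le> zz j \<and> x \<le> zz (Suc j))"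

lemma link_le:
  assumes "j < m"
  shows "link j \<le> zz j" "link j \<le> zz (Suc j)"
proof -
  have "\<exists>x. x \<le> zz j \<and> x \<le> zz (Suc j)"
    using zz_linked[OF assms] by (auto simp: linked_def)
  then have "link j \<le> zz j \<and> link j \<le> zz (Suc j)"
    unfolding link_def by (rule someI_ex)
  then show "link j \<le> zz j" "link j \<le> zz (Suc j)"
    by auto
qed

lemma link_unique: "j < m \<Longrightarrow> x \<le> zz j \<Longrightarrow> x \<le> zz (Suc j) \<Longrightarrow> x = link j"
  using common_lower_unique[of x "zz j" "zz (Suc j)" "link j"] link_le zz_max zz_eq_iff[of j "Suc j"] by simp

lemma link_minimal: "j < m \<Longrightarrow> x \<le> link j \<Longrightarrow> x = link j"
  using link_unique link_le order_trans by blast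

lemma link_less: "j < m \<Longrightarrow> link j < zz j" "j < m \<Longrightarrow> link j < zz (Suc j)"
  using max_points_lessI[of "link j" "zz j" "zz (Suc j)"] max_points_lessI[of "link j" "zz (Suc j)" "zz j"]
    link_le zz_max zz_eq_iff[of j "Suc j"] by simp_all

lemma link_le_zzD:
  assumes "j < m" "k \<le> m" "link j \<le> zz k"
  shows "k = j \<or> k = Suc j"
  using at_most_two_peaks[of "link j" "zz j" "zz (Suc j)" "zz k"] link_le assms zz_max
    zz_eq_iff[of j k] zz_eq_iff[of "Suc j" k] zz_eq_iff[of j "Suc j"] by auto

lemma link_support: "j < m \<Longrightarrow> u \<in> U (link j) \<Longrightarrow> z \<noteq> zz j \<Longrightarrow> z \<noteq> zz (Suc j) \<Longrightarrow> u z = 0"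
proof (rule ccontr)
  assume "j < m" "u \<in> U (link j)" "u z \<noteq> 0" "z \<noteq> zz j" "z \<noteq> zz (Suc j)"
  then show False
    using U_support[of u "link j" z] at_most_two_peaks[of "link j" "zz j" "zz (Suc j)" z] link_le zz_max
      zz_eq_iff[of j "Suc j"] by (auto simp: support_def)
qed

text \<open>A minimal \<open>b\<close> is comparable only with points above it. Two incomparable
  points under \<open>z\<close> that are not above \<open>b\<close> would therefore form an
  antichain of size three with \<open>b\<close>.\<close>

lemma not_above_link_chain:
  fixes b x y z :: 'p
  assumes b: "b < z" "\<And>x. x \<le> b \<Longrightarrow> x = b" and z: "z \<in> max_points"
    and x: "x \<le> z" "\<not> b \<le> x" and y: "y \<le> z" "\<not> b \<le> y"
  shows "x \<le> y \<or> y \<le> x"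
proof -
  have "x < z" "y < z"
    using x y b(1) by (auto simp: less_le)
  then show ?thesis
    using width_le_2[OF z _ _ b(1), of x y] b(2) x y by blast
qed

text \<open>\<open>link j\<close> is itself below \<open>zz (Suc j)\<close> and not above
  \<open>link (Suc j)\<close>, so \<open>x\<close> is comparable with it; and \<open>link j\<close>
  is minimal. Hence all that arrives through the left link lies in the coordinate subspace of each
  such \<open>x\<close>.\<close>

lemma link_le_other:
  assumes j: "Suc j < m" and x: "x \<le> zz (Suc j)" "\<not> link (Suc j) \<le> x"
  shows "link j \<le> x"
proof -
  have "\<not> link (Suc j) \<le> link j"
  proof
    assume "link (Suc j) \<le> link j"
    then have "link (Suc j) \<le> zz j"
      using link_le(1)[of j] j by auto
    then show False
      using link_le_zzD[of "Suc j" j] j by simp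
  qed
  then have "x \<le> link j \<or> link j \<le> x"
    using not_above_link_chain[of "link (Suc j)" "zz (Suc j)" x "link j"] link_less link_minimal[of "Suc j"]
      link_le[of j] zz_max x j by auto
  then show ?thesis
    using link_minimal[of j x] j by auto
qed

section \<open>Subspaces transported from the left\<close>

abbreviation V :: "nat \<Rightarrow> 'v set" where
  "V j \<equiv> summand U (zz j)"

abbreviation T :: "nat \<Rightarrow> 'v set \<Rightarrow> 'v set" where
  "T j \<equiv> transfer (U (link j)) (zz j) (zz (Suc j))"

text \<open>
  The subspaces above \<open>link j\<close> contain the domain of the relation \<open>U (link j)\<close>, so they carry no
  information to the right and are not transported.
\<close>
primrec left_chain :: "nat \<Rightarrow> 'v set set" where
  "left_chain 0 = {}"
| "left_chain (Suc j) = T j ` ({{0}, V j} \<union> (left_chain j \<union> {values_at x (zz j) |x. x \<le> zz j \<and> \<not> link j \<le> x}))"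

text \<open>Besides \<open>{0}\<close> and \<open>V j\<close>, these are the subspaces transported
  through \<open>link j\<close>; the recursion for \<open>left_chain\<close> has to spell them
  out.\<close>

definition free_chain :: "nat \<Rightarrow> 'v set set" where
  "free_chain j = left_chain j \<union> {values_at x (zz j) |x. x \<le> zz j \<and> \<not> link j \<le> x}"

lemma left_chain_Suc: "left_chain (Suc j) = T j ` ({{0}, V j} \<union> free_chain j)"
  by (simp add: free_chain_def)

declare left_chain.simps(2) [simp del]

lemma subspace_V: "subspace (V j)"
  by (rule subspace_summand)

lemma transfer_values: "T j F \<subseteq> values_at (link j) (zz (Suc j))"
  by (auto simp: transfer_def values_at_def)

lemma transfer_V: "j < m \<Longrightarrow> T j (V j) = values_at (link j) (zz (Suc j))"
  using U_summand zz_max by (force simp: transfer_def values_at_def)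

lemma left_chain_finite: "finite (left_chain j)"
proof (induction j)
  case (Suc j)
  have "finite {values_at x (zz j) |x. x \<le> zz j \<and> \<not> link j \<le> x}"
    by (rule finite_subset[of _ "range (\<lambda>x. values_at x (zz j))"]) auto
  with Suc show ?case
    by (simp add: left_chain_Suc free_chain_def)
qed simp

lemma free_chain_finite: "finite (free_chain j)"
proof -
  have "finite {values_at x (zz j) |x. x \<le> zz j \<and> \<not> link j \<le> x}"
    by (rule finite_subset[of _ "range (\<lambda>x. values_at x (zz j))"]) auto
  then show ?thesis
    using left_chain_finite by (simp add: free_chain_def)
qed

lemma left_chain_subspace: "F \<in> left_chain j \<Longrightarrow> subspace F"
proof (induction j arbitrary: F)
  case (Suc j)
  then obtain G where G: "F = T j G" "G \<in> {{0}, V j} \<union> free_chain j"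
    by (auto simp: left_chain_Suc)
  then have "subspace G"
    using Suc.IH subspace_V subspace_values_at by (auto simp: free_chain_def)
  then show ?case
    using G(1) subspace_transfer[OF subspace_U] by blast
qed simp

lemma free_chain_subspace: "F \<in> free_chain j \<Longrightarrow> subspace F"
  using left_chain_subspace subspace_values_at by (auto simp: free_chain_def)

lemma left_chain_link: "F \<in> left_chain (Suc j) \<Longrightarrow> F \<subseteq> values_at (link j) (zz (Suc j))"
  using transfer_values by (auto simp: left_chain_Suc)

lemma left_chain_V: "j \<le> m \<Longrightarrow> F \<in> left_chain j \<Longrightarrow> F \<subseteq> V j"
  using left_chain_link values_at_summand[OF zz_max] by (cases j) fastforce+

lemma free_chain_V: "j \<le> m \<Longrightarrow> F \<in> free_chain j \<Longrightarrow> F \<subseteq> V j"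
  unfolding free_chain_def using left_chain_V values_at_summand[OF zz_max] by blast

text \<open>Members of \<open>left_chain j\<close> lie in the coordinate subspace of the previous
  link, which by \<open>link_le_other\<close> lies in that of every \<open>x\<close> not above
  \<open>link j\<close>. The subspaces of such \<open>x\<close> are nested by
  \<open>not_above_link_chain\<close>.\<close>

lemma free_chain_chain:
  assumes j: "j < m"
    and left: "\<And>F G. F \<in> left_chain j \<Longrightarrow> G \<in> left_chain j \<Longrightarrow> F \<subseteq> G \<or> G \<subseteq> F"
    and FG: "F \<in> free_chain j" "G \<in> free_chain j"
  shows "F \<subseteq> G \<or> G \<subseteq> F"
proof -
  have mixed: "F \<subseteq> values_at x (zz j)" if F: "F \<in> left_chain j" and x: "x \<le> zz j" "\<not> link j \<le> x" for F x
  proof (cases j)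
    case 0
    then show ?thesis using F by simp
  next
    case (Suc i)
    then have "link i \<le> x"
      using link_le_other[of i x] x j by simp
    then show ?thesis
      using left_chain_link[of F i] values_at_mono[of "link i" x "zz j"] F x Suc by auto
  qed
  have vals: "values_at x (zz j) \<subseteq> values_at y (zz j) \<or> values_at y (zz j) \<subseteq> values_at x (zz j)"
    if "x \<le> zz j" "\<not> link j \<le> x" "y \<le> zz j" "\<not> link j \<le> y" for x y
    using not_above_link_chain[of "link j" "zz j" x y] link_less[OF j] link_minimal[OF j] zz_max[of j] j
      values_at_mono[of x y "zz j"] values_at_mono[of y x "zz j"] that by auto
  consider "F \<in> left_chain j" "G \<in> left_chain j"
    | x where "F \<in> left_chain j" "G = values_at x (zz j)" "x \<le> zz j" "\<not> link j \<le> x"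
    | x where "G \<in> left_chain j" "F = values_at x (zz j)" "x \<le> zz j" "\<not> link j \<le> x"
    | x y where "F = values_at x (zz j)" "x \<le> zz j" "\<not> link j \<le> x" "G = values_at y (zz j)" "y \<le> zz j" "\<not> link j \<le> y"
    using FG by (auto simp: free_chain_def)
  then show ?thesis
    by cases (use left mixed vals in blast)+
qed

text \<open>Transfer is monotone, and \<open>{0}\<close> and \<open>V j\<close> bound
  \<open>free_chain j\<close> from below and above. The induction hypothesis enters as the premise
  \<open>left\<close> of \<open>free_chain_chain\<close>.\<close>

lemma left_chain_chain: "j \<le> m \<Longrightarrow> F \<in> left_chain j \<Longrightarrow> G \<in> left_chain j \<Longrightarrow> F \<subseteq> G \<or> G \<subseteq> F"
proof (induction j arbitrary: F G)
  case (Suc j)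
  have chain: "A \<subseteq> B \<or> B \<subseteq> A" if "A \<in> free_chain j" "B \<in> free_chain j" for A B
    using free_chain_chain[of j A B] Suc that by simp
  obtain A B where AB: "F = T j A" "G = T j B" "A \<in> {{0}, V j} \<union> free_chain j" "B \<in> {{0}, V j} \<union> free_chain j"
    using Suc.prems by (auto simp: left_chain_Suc)
  have bounds: "{0} \<subseteq> A \<and> A \<subseteq> V j" if "A \<in> {{0}, V j} \<union> free_chain j" for A
    using that free_chain_V[of j A] free_chain_subspace[of A j] subspace_0[of A] subspace_0[OF subspace_V] Suc.prems
    by auto
  consider "A = {0}" | "B = {0}" | "A = V j" | "B = V j" | "A \<in> free_chain j" "B \<in> free_chain j"
    using AB(3,4) by blast
  then have "A \<subseteq> B \<or> B \<subseteq> A"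
    by cases (use bounds[OF AB(3)] bounds[OF AB(4)] chain[of A B] in simp_all)
  then show ?case
    unfolding AB(1,2) by (rule disj_forward) (rule transfer_mono, assumption)+
qed simp

text \<open>The relation at \<open>link j\<close> is exempt: it is dealt with when passing to \<open>Suc j\<close>.\<close>
definition thin :: "nat \<Rightarrow> 'v \<Rightarrow> ('v \<Rightarrow> 'k) \<Rightarrow> bool" where
  "thin j v h \<longleftrightarrow> v \<in> V j \<and> functional h \<and> h v = 1 \<and>
    (\<forall>F\<in>left_chain j. v \<in> F \<or> (\<forall>a\<in>F. h a = 0)) \<and>
    (\<forall>x. x \<le> zz j \<longrightarrow> \<not> (j < m \<and> x = link j) \<longrightarrow>
      v \<in> values_at x (zz j) \<or> (\<forall>a\<in>values_at x (zz j). h a = 0))"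

text \<open>At the end of the path all points below \<open>zz m\<close> count, and their subspaces
  need not be nested, but have width two by \<open>width_le_2\<close>. Adding the chain from the
  left keeps the width, so \<open>thin_vector_exists\<close> applies.\<close>

lemma thin_last: "\<exists>v h. thin m v h"
proof -
  let ?E = "{values_at x (zz m) |x. x \<le> zz m}"
  have "width2 ?E"
    unfolding width2_def
  proof (intro ballI)
    fix A B C assume "A \<in> ?E" "B \<in> ?E" "C \<in> ?E"
    then obtain x y t where xyt: "A = values_at x (zz m)" "B = values_at y (zz m)" "C = values_at t (zz m)"
      "x \<le> zz m" "y \<le> zz m" "t \<le> zz m"
      by blast
    have "x \<le> y \<or> y \<le> x \<or> x \<le> t \<or> t \<le> x \<or> y \<le> t \<or> t \<le> y"
      using width_le_2[of "zz m" x y t] zz_max[of m] xyt(4-6) by (cases "x = zz m"; cases "y = zz m"; cases "t = zz m") auto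
    then show "A \<subseteq> B \<or> B \<subseteq> A \<or> A \<subseteq> C \<or> C \<subseteq> A \<or> B \<subseteq> C \<or> C \<subseteq> B"
      using xyt values_at_mono by metis
  qed
  \<comment> \<open>\<open>A\<close> has come through the last link, so it lies in the subspace of
    every point above that link; two points not above it are comparable.\<close>
  moreover have "A \<subseteq> B \<or> A \<subseteq> C \<or> B \<subseteq> C \<or> C \<subseteq> B" if "A \<in> left_chain m" "B \<in> ?E" "C \<in> ?E" for A B C
  proof -
    obtain j where j: "m = Suc j"
      using \<open>A \<in> left_chain m\<close> by (cases m) auto
    obtain x y where xy: "B = values_at x (zz m)" "C = values_at y (zz m)" "x \<le> zz m" "y \<le> zz m"
      using \<open>B \<in> ?E\<close> \<open>C \<in> ?E\<close> by blast
    have A: "A \<subseteq> values_at (link j) (zz m)"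
      using left_chain_link \<open>A \<in> left_chain m\<close> j by simp
    consider "link j \<le> x" | "link j \<le> y" | "\<not> link j \<le> x" "\<not> link j \<le> y" by blast
    then show ?thesis
    proof cases
      case 3
      then have "x \<le> y \<or> y \<le> x"
        using not_above_link_chain[of "link j" "zz m" x y] link_less[of j] link_minimal[of j] zz_max[of m] j xy by auto
      then show ?thesis
        using values_at_mono[of x y "zz m"] values_at_mono[of y x "zz m"] xy by auto
    qed (use A values_at_mono[of "link j" _ "zz m"] xy in blast)+
  qed
  ultimately have w: "width2 (left_chain m \<union> ?E)"
    using width2_Un[of "left_chain m" ?E] left_chain_chain[of m] by blast
  have fin: "finite (left_chain m \<union> ?E)"
    using left_chain_finite finite_subset[of ?E "range (\<lambda>x. values_at x (zz m))"] by auto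
  have sub: "subspace G" if "G \<in> left_chain m \<union> ?E" for G
    using that left_chain_subspace subspace_values_at by blast
  have V: "V m \<in> left_chain m \<union> ?E"
    using values_at_self[OF zz_max[of m]] by blast
  have "V m \<noteq> {0}"
  proof
    assume V0: "V m = {0}"
    have "u = 0" if u: "u \<in> U (zz m)" for u
    proof -
      have "u (zz m) = 0"
        using U_summand[OF u zz_max[of m]] V0 by simp
      then show ?thesis
        using U_max[OF zz_max[of m] u] by (auto simp: at_point_def fun_eq_iff)
    qed
    then have "U (zz m) = {0}"
      using F.subspace_0[OF subspace_U[of "zz m"]] by blast
    then show False
      using zz_support[of m] by (simp add: support_def)
  qed
  moreover have "G \<subseteq> V m" if "G \<in> left_chain m \<union> ?E" for G
    using that left_chain_V[of m] values_at_summand[OF zz_max[of m]] by auto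
  ultimately obtain v h where "v \<in> V m" "functional h" "h v = 1"
    "\<And>G. G \<in> left_chain m \<union> ?E \<Longrightarrow> v \<in> G \<or> (\<forall>g\<in>G. h g = 0)"
    using thin_vector_exists[OF fin sub w V] by blast
  then have "thin m v h"
    unfolding thin_def by blast
  then show ?thesis by blast
qed

text \<open>By thinness, \<open>not0\<close> says that \<open>h\<close> kills the indeterminacy of
  the relation and \<open>not1\<close> that \<open>v\<close> lies in its range, as
  \<open>thin_vector_lift\<close> requires. Points above \<open>link j\<close> are absent from
  \<open>free_chain j\<close>, but their subspaces contain \<open>w (zz j)\<close> because
  \<open>w \<in> U (link j)\<close>.\<close>

lemma thin_lift:
  assumes j: "j < m" and thin: "thin (Suc j) v h"
    and not0: "v \<notin> T j {0}" and not1: "\<not> (\<forall>a\<in>T j (V j). h a = 0)"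
  obtains w g where "thin j (w (zz j)) g" "w \<in> U (link j)" "w (zz (Suc j)) = v"
    "\<And>u. u \<in> U (link j) \<Longrightarrow> g (u (zz j)) = h (u (zz (Suc j)))"
proof -
  have h: "functional h" "h v = 1"
    using thin by (auto simp: thin_def)
  have left: "v \<in> T j F \<or> (\<forall>a\<in>T j F. h a = 0)" if "F \<in> {{0}, V j} \<union> free_chain j" for F
    using thin that unfolding thin_def left_chain_Suc by blast
  have v: "v \<in> (\<lambda>u. u (zz (Suc j))) ` U (link j)"
    using left[of "V j"] not1 transfer_V[OF j] by (auto simp: values_at_def)
  have h0: "h (u (zz (Suc j))) = 0" if "u \<in> U (link j)" "u (zz j) = 0" for u
    using left[of "{0}"] not0 that by (auto simp: transfer_def)
  have left': "v \<in> T j F \<or> (\<forall>a\<in>T j F. h a = 0)" if "F \<in> free_chain j" for F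
    using left that by blast
  have chain: "F \<subseteq> G \<or> G \<subseteq> F" if "F \<in> free_chain j" "G \<in> free_chain j" for F G
    using free_chain_chain[OF j _ that] left_chain_chain[of j] j by simp
  show thesis
  proof (rule thin_vector_lift[where X = "U (link j)" and \<C> = "free_chain j" and y = "zz j" and z = "zz (Suc j)"
        and v = v and h = h, OF subspace_U free_chain_finite free_chain_subspace chain v h])
    show "h (u (zz (Suc j))) = 0" if "u \<in> U (link j)" "u (zz j) = 0" for u
      using that by (rule h0)
    show "v \<in> T j F \<or> (\<forall>a\<in>T j F. h a = 0)" if "F \<in> free_chain j" for F
      using that by (rule left')
  next
    fix w g
    assume w: "w \<in> U (link j)" "w (zz (Suc j)) = v" and g: "functional g" "g (w (zz j)) = 1"
      and gh: "\<And>u. u \<in> U (link j) \<Longrightarrow> g (u (zz j)) = h (u (zz (Suc j)))"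
      and free: "\<And>F. F \<in> free_chain j \<Longrightarrow> w (zz j) \<in> F \<or> (\<forall>a\<in>F. g a = 0)"
    have "thin j (w (zz j)) g"
      unfolding thin_def
    proof (intro conjI ballI allI impI)
      show "w (zz j) \<in> V j"
        using U_summand[OF w(1)] zz_max j by simp
      show "w (zz j) \<in> F \<or> (\<forall>a\<in>F. g a = 0)" if "F \<in> left_chain j" for F
        using free that by (simp add: free_chain_def)
      show "w (zz j) \<in> values_at x (zz j) \<or> (\<forall>a\<in>values_at x (zz j). g a = 0)" if x: "x \<le> zz j" for x
      proof (cases "link j \<le> x")
        case True
        then show ?thesis
          using values_at_mono[OF True x] values_atI[OF w(1)] by blast
      next
        case False
        then have "values_at x (zz j) \<in> free_chain j"
          using x by (auto simp: free_chain_def)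
        then show ?thesis
          by (rule free)
      qed
    qed (use g in auto)
    then show thesis
      using that w gh by blast
  qed
qed

section \<open>Rank one endomorphisms along the string\<close>

definition rank1 :: "('p \<Rightarrow> 'v) \<Rightarrow> ('p \<Rightarrow> 'v \<Rightarrow> 'k) \<Rightarrow> 'p \<Rightarrow> 'v \<Rightarrow> 'v" where
  "rank1 vv hh z a = s (hh z a) (vv z)"

lemma rank1_multiple:
  assumes "w \<in> W" "F.subspace W" "\<And>z. s (hh z (u z)) (vv z) = s c (w z)"
  shows "peak_endo (rank1 vv hh) u \<in> W"
proof -
  have "peak_endo (rank1 vv hh) u = fun_scale s c w"
    using assms(3) by (auto simp: peak_endo_def rank1_def fun_scale_def)
  then show ?thesis
    using F.subspace_scale assms(1,2) by simp
qed

lemma rank1_zero: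
  assumes "F.subspace W" "\<And>z. s (hh z (u z)) (vv z) = 0"
  shows "peak_endo (rank1 vv hh) u \<in> W"
  by (rule rank1_multiple[OF F.subspace_0[OF assms(1)] assms(1), of _ _ _ 0]) (simp add: assms)

text \<open>One more pair is added at \<open>zz i\<close>. Nothing changes for \<open>x\<close> not
  below \<open>zz i\<close>; the link to the left is covered by \<open>new\<close>; for any other
  \<open>x\<close> the only nonzero peak above it is \<open>zz i\<close>, where thinness
  decides.\<close>

lemma extend_endo:
  assumes i: "i \<le> m" and thin: "thin i v h" and func: "\<And>z. functional (hh z)"
    and old: "\<And>x u. (\<And>j. i \<le> j \<Longrightarrow> j \<le> m \<Longrightarrow> \<not> x \<le> zz j) \<Longrightarrow> u \<in> U x \<Longrightarrow> peak_endo (rank1 vv hh) u \<in> U x"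
    and new: "\<And>j u. i = Suc j \<Longrightarrow> u \<in> U (link j) \<Longrightarrow>
      peak_endo (rank1 (vv(zz i := v)) (hh(zz i := h))) u \<in> U (link j)"
    and later: "\<And>j. i < j \<Longrightarrow> j \<le> m \<Longrightarrow> \<not> x \<le> zz j" and u: "u \<in> U x"
  shows "peak_endo (rank1 (vv(zz i := v)) (hh(zz i := h))) u \<in> U x"
proof -
  have h: "functional h"
    using thin by (simp add: thin_def)
  consider "\<not> x \<le> zz i" | j where "x \<le> zz i" "i = Suc j" "x \<le> zz j"
    | "x \<le> zz i" "\<And>j. i = Suc j \<Longrightarrow> \<not> x \<le> zz j"
    by blast
  then show ?thesis
  proof cases
    case 1
    then have "u (zz i) = 0"
      using U_zero[OF u] by blast
    then have "peak_endo (rank1 (vv(zz i := v)) (hh(zz i := h))) u = peak_endo (rank1 vv hh) u"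
      using functional_0[OF h] functional_0[OF func] by (auto simp: peak_endo_def rank1_def fun_eq_iff)
    moreover have "\<not> x \<le> zz j" if "i \<le> j" "j \<le> m" for j
      using that later[of j] 1 by (cases "i = j") auto
    ultimately show ?thesis
      using old[OF _ u] by simp
  next
    case (2 j)
    then have "x = link j"
      using link_unique[of j x] i by simp
    then show ?thesis
      using new[of j u] 2 u by simp
  next
    case 3
    \<comment> \<open>A nonzero peak linked to \<open>zz i\<close> is its neighbour on the path; the
      right one is excluded by \<open>later\<close>, the left one by the case.\<close>
    have off: "u z = 0" if u: "u \<in> U x" and z: "z \<noteq> zz i" for u z
    proof (rule ccontr)
      assume "u z \<noteq> 0"
      then have "z \<in> support" "x \<le> z"
        using U_support u by blast+
      moreover from this have "linked (zz i) z"
        using 3(1) z by (auto simp: linked_def)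
      ultimately obtain k where "k \<le> m" "z = zz k" "k = Suc i \<or> i = Suc k"
        using zz_component i by blast
      then show False
        using later[of k] 3(2)[of k] \<open>x \<le> z\<close> by auto
    qed
    have "\<not> (i < m \<and> x = link i)"
      using later[of "Suc i"] link_le(2)[of i] by auto
    then consider "v \<in> values_at x (zz i)" | "\<forall>a\<in>values_at x (zz i). h a = 0"
      using thin 3(1) unfolding thin_def by blast
    then show ?thesis
    proof cases
      case 1
      then obtain w where w: "w \<in> U x" "w (zz i) = v"
        by (auto simp: values_at_def)
      show ?thesis
      proof (rule rank1_multiple[OF w(1) subspace_U, where c = "h (u (zz i))"])
        show "s ((hh(zz i := h)) z (u z)) ((vv(zz i := v)) z) = s (h (u (zz i))) (w z)" for z
          using w off[OF u, of z] off[OF w(1), of z] functional_0[OF func] by auto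
      qed
    next
      case 2
      show ?thesis
      proof (rule rank1_zero[OF subspace_U])
        show "s ((hh(zz i := h)) z (u z)) ((vv(zz i := v)) z) = 0" for z
          using 2 values_atI[OF u] off[OF u, of z] functional_0[OF func] by auto
      qed
    qed
  qed
qed

text \<open>The string occupies \<open>zz k\<close> to \<open>zz i\<close>. The last clause is
  restricted to points below no later peak; for \<open>i = m\<close> this means all points, and the
  family is an endomorphism of \<open>U\<close>.\<close>

definition thin_string :: "nat \<Rightarrow> nat \<Rightarrow> ('p \<Rightarrow> 'v) \<Rightarrow> ('p \<Rightarrow> 'v \<Rightarrow> 'k) \<Rightarrow> bool" where
  "thin_string k i vv hh \<longleftrightarrow> k \<le> i \<and> (\<forall>z. functional (hh z)) \<and>
    (\<forall>z. z \<notin> zz ` {k..i} \<longrightarrow> vv z = 0) \<and> (\<forall>z\<in>zz ` {k..i}. hh z (vv z) = 1) \<and>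
    (\<forall>j. k \<le> j \<longrightarrow> j < i \<longrightarrow>
      (\<exists>w\<in>U (link j). w (zz j) = vv (zz j) \<and> w (zz (Suc j)) = vv (zz (Suc j))) \<and>
      (\<forall>u\<in>U (link j). hh (zz j) (u (zz j)) = hh (zz (Suc j)) (u (zz (Suc j))))) \<and>
    (\<forall>x. (\<forall>j. i < j \<longrightarrow> j \<le> m \<longrightarrow> \<not> x \<le> zz j) \<longrightarrow> (\<forall>u\<in>U x. peak_endo (rank1 vv hh) u \<in> U x))"

lemma thin_string_start:
  assumes i: "i \<le> m" and thin: "thin i v h"
    and new: "\<And>j u. i = Suc j \<Longrightarrow> u \<in> U (link j) \<Longrightarrow>
      peak_endo (rank1 ((\<lambda>_. 0)(zz i := v)) ((\<lambda>_ _. 0)(zz i := h))) u \<in> U (link j)"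
  shows "thin_string i i ((\<lambda>_. 0)(zz i := v)) ((\<lambda>_ _. 0)(zz i := h))"
proof -
  have h: "functional h" "h v = 1"
    using thin by (auto simp: thin_def)
  have z: "functional (\<lambda>_. 0)"
    by (simp add: functional_def)
  have "peak_endo (rank1 ((\<lambda>_. 0)(zz i := v)) ((\<lambda>_ _. 0)(zz i := h))) u \<in> U x"
    if "\<forall>j. i < j \<longrightarrow> j \<le> m \<longrightarrow> \<not> x \<le> zz j" "u \<in> U x" for x u
  proof (rule extend_endo[OF i thin z _ new _ that(2)])
    show "peak_endo (rank1 (\<lambda>_. 0) (\<lambda>_ _. 0)) u \<in> U x" for x u
      by (rule rank1_zero[OF subspace_U]) simp
  qed (use that in auto)
  then show ?thesis
    unfolding thin_string_def using h z by auto
qed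

text \<open>The string is continued to the left by induction. It stops at \<open>zz (Suc i)\<close>
  if the relation at \<open>link i\<close> relates 0 to \<open>v\<close>, or if \<open>h\<close>
  vanishes on its range: then the relation is preserved without any contribution from the left.
  Otherwise \<open>thin_lift\<close> supplies the next pair.\<close>

lemma thin_string_exists:
  assumes "i \<le> m" "thin i v h"
  shows "\<exists>k vv hh. thin_string k i vv hh \<and> vv (zz i) = v \<and> hh (zz i) = h"
  using assms
proof (induction i arbitrary: v h)
  case 0
  have "thin_string 0 0 ((\<lambda>_. 0)(zz 0 := v)) ((\<lambda>_ _. 0)(zz 0 := h))"
    using 0 by (intro thin_string_start) auto
  then show ?case
    by - (rule exI, rule exI, rule exI, rule conjI, assumption, simp)
next
  case (Suc i)
  have i: "i < m"
    using Suc.prems by simp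
  have h: "functional h" "h v = 1"
    using Suc.prems by (auto simp: thin_def)
  have ne: "zz i \<noteq> zz (Suc i)"
    using zz_eq_iff[of i "Suc i"] i by simp
  consider "v \<in> T i {0}" | "\<forall>a\<in>T i (V i). h a = 0" | "v \<notin> T i {0}" "\<not> (\<forall>a\<in>T i (V i). h a = 0)"
    by blast
  then show ?case
  proof cases
    case 1
    then obtain w where w: "w \<in> U (link i)" "w (zz i) = 0" "w (zz (Suc i)) = v"
      by (auto simp: transfer_def)
    have "thin_string (Suc i) (Suc i) ((\<lambda>_. 0)(zz (Suc i) := v)) ((\<lambda>_ _. 0)(zz (Suc i) := h))"
    proof (rule thin_string_start[OF Suc.prems])
      fix j u assume "Suc i = Suc j" and u: "u \<in> U (link j)"
      then have j: "j = i" by simp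
      show "peak_endo (rank1 ((\<lambda>_. 0)(zz (Suc i) := v)) ((\<lambda>_ _. 0)(zz (Suc i) := h))) u \<in> U (link j)"
      proof (rule rank1_multiple[OF _ subspace_U, where c = "h (u (zz (Suc i)))" and w = w])
        show "w \<in> U (link j)" using w j by simp
        show "s (((\<lambda>_ _. 0)(zz (Suc i) := h)) z (u z)) (((\<lambda>_. 0)(zz (Suc i) := v)) z) = s (h (u (zz (Suc i)))) (w z)" for z
          using w link_support[OF i w(1), of z] by auto
      qed
    qed
    then show ?thesis
      by - (rule exI, rule exI, rule exI, rule conjI, assumption, simp)
  next
    case 2
    have "thin_string (Suc i) (Suc i) ((\<lambda>_. 0)(zz (Suc i) := v)) ((\<lambda>_ _. 0)(zz (Suc i) := h))"
    proof (rule thin_string_start[OF Suc.prems])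
      fix j u assume "Suc i = Suc j" and u: "u \<in> U (link j)"
      then have "u (zz (Suc i)) \<in> T i (V i)"
        using transfer_V[OF i] values_atI by simp
      then have "h (u (zz (Suc i))) = 0"
        using 2 by blast
      then show "peak_endo (rank1 ((\<lambda>_. 0)(zz (Suc i) := v)) ((\<lambda>_ _. 0)(zz (Suc i) := h))) u \<in> U (link j)"
        by (intro rank1_zero[OF subspace_U]) simp
    qed
    then show ?thesis
      by - (rule exI, rule exI, rule exI, rule conjI, assumption, simp)
  next
    case 3
    then obtain w g where w: "thin i (w (zz i)) g" "w \<in> U (link i)" "w (zz (Suc i)) = v"
      and gh: "\<And>u. u \<in> U (link i) \<Longrightarrow> g (u (zz i)) = h (u (zz (Suc i)))"
      using thin_lift[OF i Suc.prems(2)] by blast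
    obtain k vv hh where old: "thin_string k i vv hh" and vv: "vv (zz i) = w (zz i)" and hh: "hh (zz i) = g"
      using Suc.IH[OF _ w(1)] i by auto
    let ?vv = "vv(zz (Suc i) := v)" and ?hh = "hh(zz (Suc i) := h)"
    have k: "k \<le> i" and func: "\<And>z. functional (hh z)"
      and out: "\<And>z. z \<notin> zz ` {k..i} \<Longrightarrow> vv z = 0" and one: "\<And>z. z \<in> zz ` {k..i} \<Longrightarrow> hh z (vv z) = 1"
      and lnk: "\<And>j. k \<le> j \<Longrightarrow> j < i \<Longrightarrow>
        (\<exists>w\<in>U (link j). w (zz j) = vv (zz j) \<and> w (zz (Suc j)) = vv (zz (Suc j))) \<and>
        (\<forall>u\<in>U (link j). hh (zz j) (u (zz j)) = hh (zz (Suc j)) (u (zz (Suc j))))"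
      and inv: "\<And>x u. (\<And>j. i < j \<Longrightarrow> j \<le> m \<Longrightarrow> \<not> x \<le> zz j) \<Longrightarrow> u \<in> U x \<Longrightarrow> peak_endo (rank1 vv hh) u \<in> U x"
      using old unfolding thin_string_def by blast+
    have upd: "?vv (zz j) = vv (zz j)" "?hh (zz j) = hh (zz j)" if "j \<le> i" for j
      using that zz_eq_iff[of j "Suc i"] i by auto
    have split: "zz ` {k..Suc i} = insert (zz (Suc i)) (zz ` {k..i})"
      using k by (simp add: atLeastAtMostSuc_conv)
    have 1: "functional (?hh z)" for z
      using func h by simp
    have 2: "?vv z = 0" if "z \<notin> zz ` {k..Suc i}" for z
      using that out[of z] split by simp
    have 3: "?hh z (?vv z) = 1" if "z \<in> zz ` {k..Suc i}" for z
      using that one[of z] split h by auto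
    have 4: "(\<exists>w\<in>U (link j). w (zz j) = ?vv (zz j) \<and> w (zz (Suc j)) = ?vv (zz (Suc j))) \<and>
        (\<forall>u\<in>U (link j). ?hh (zz j) (u (zz j)) = ?hh (zz (Suc j)) (u (zz (Suc j))))"
      if j: "k \<le> j" "j < Suc i" for j
    proof (cases "j = i")
      case True
      show ?thesis
        unfolding True using w(2,3) gh vv hh ne by auto
    next
      case False
      then have "j < i" using j by simp
      then show ?thesis
        using lnk[OF j(1)] upd[of j] upd[of "Suc j"] by simp
    qed
    have 5: "peak_endo (rank1 ?vv ?hh) u \<in> U x"
      if "\<forall>j. Suc i < j \<longrightarrow> j \<le> m \<longrightarrow> \<not> x \<le> zz j" "u \<in> U x" for x u
    proof (rule extend_endo[OF Suc.prems func _ _ _ that(2)])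
      show "peak_endo (rank1 vv hh) u \<in> U x"
        if "\<And>j. Suc i \<le> j \<Longrightarrow> j \<le> m \<Longrightarrow> \<not> x \<le> zz j" "u \<in> U x" for x u
        using that by (intro inv) auto
      \<comment> \<open>By \<open>gh\<close> the scalars at both ends of the link agree, so
        \<open>u\<close> goes to a multiple of \<open>w\<close>.\<close>
      show "peak_endo (rank1 ?vv ?hh) u \<in> U (link j)" if "Suc i = Suc j" and u: "u \<in> U (link j)" for j u
      proof (rule rank1_multiple[OF _ subspace_U, where c = "h (u (zz (Suc i)))" and w = w])
        have j: "j = i" using that by simp
        show "w \<in> U (link j)" using w j by simp
        show "s (?hh z (u z)) (?vv z) = s (h (u (zz (Suc i)))) (w z)" for z
        proof -
          consider "z = zz (Suc i)" | "z = zz i" | "z \<noteq> zz (Suc i)" "z \<noteq> zz i" by blast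
          then show ?thesis
          proof cases
            case 1
            then show ?thesis using w by simp
          next
            case 2
            then show ?thesis using ne vv hh gh[of u] u j by simp
          next
            case 3
            then have "u z = 0" "w z = 0"
              using link_support[OF i, of _ z] u w(2) j by auto
            then show ?thesis
              using functional_0[OF 1[of z]] by simp
          qed
        qed
      qed
    qed (use that in auto)
    have "thin_string k (Suc i) ?vv ?hh"
      unfolding thin_string_def
      using k 1 2 3 4 5 le_SucI[OF k] by blast
    then show ?thesis
      by - (rule exI, rule exI, rule exI, rule conjI, assumption, simp)
  qed
qed

end

section \<open>Stability\<close>

text \<open>\<open>Suc\<close> maps these \<open>j\<close> injectively into \<open>S\<close> and
  misses the minimum of \<open>S\<close>.\<close>

lemma card_consecutive_less:
  fixes S :: "nat set"
  assumes "finite S" "S \<noteq> {}"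
  shows "card {j. j \<in> S \<and> Suc j \<in> S} < card S"
proof -
  have "Suc ` {j. j \<in> S \<and> Suc j \<in> S} \<subseteq> S - {Min S}"
  proof (rule image_subsetI)
    fix j assume "j \<in> {j. j \<in> S \<and> Suc j \<in> S}"
    moreover from this have "Min S \<le> j"
      using Min_le[OF assms(1)] by blast
    ultimately show "Suc j \<in> S - {Min S}"
      by auto
  qed
  moreover have "card (Suc ` {j. j \<in> S \<and> Suc j \<in> S}) = card {j. j \<in> S \<and> Suc j \<in> S}"
    by (rule card_image) simp
  ultimately have "card {j. j \<in> S \<and> Suc j \<in> S} \<le> card (S - {Min S})"
    using card_mono[of "S - {Min S}" "Suc ` {j. j \<in> S \<and> Suc j \<in> S}"] assms(1) by simp
  then show ?thesis
    using card_Diff1_less[OF assms(1) Min_in[OF assms]] by simp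
qed

lemma at_point_0: "at_point z 0 = 0"
  by (simp add: at_point_def fun_eq_iff)

context peak_space_locale
begin

section \<open>Subspaces of lines and admissible subspaces\<close>

lemma dim_line:
  assumes W: "F.subspace W" and w: "w \<noteq> 0" and line: "\<And>u. u \<in> W \<Longrightarrow> \<exists>c. u = fun_scale s c w"
  shows "F.dim W = (if w \<in> W then 1 else 0)"
proof (cases "w \<in> W")
  case True
  have "W = F.span {w}"
  proof
    show "W \<subseteq> F.span {w}"
      using line by (auto simp: F.span_singleton)
    show "F.span {w} \<subseteq> W"
      using True W by (intro F.span_minimal) auto
  qed
  moreover have "F.independent {w}"
    using w F.dependent_single by blast
  ultimately show ?thesis
    using True F.dim_span_eq_card_independent[of "{w}"] by simp
next
  case False
  have "u = 0" if u: "u \<in> W" for u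
  proof -
    obtain c where c: "u = fun_scale s c w"
      using line[OF u] by blast
    have "c = 0"
    proof (rule ccontr)
      assume "c \<noteq> 0"
      then have "w = fun_scale s (inverse c) u"
        unfolding c by (simp only: F.scale_scale left_inverse[OF \<open>c \<noteq> 0\<close>] F.scale_one)
      then show False
        using F.subspace_scale[OF W u, of "inverse c"] False by simp
    qed
    then show ?thesis
      unfolding c by (simp only: F.scale_zero_left)
  qed
  then have "W = F.span {}"
    using F.subspace_0[OF W] unfolding F.span_empty by blast
  then show ?thesis
    using False F.dim_span_eq_card_independent[of "{}"] F.independent_empty by simp
qed

lemma subspace_max_sum:
  assumes "\<And>z. z \<in> max_points \<Longrightarrow> subspace (L z)"
  shows "F.subspace (max_sum L)"
proof (rule F.subspaceI)
  show "0 \<in> max_sum L"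
    using subspace_0[OF assms] by (simp add: max_sum_def)
  show "u + v \<in> max_sum L" if "u \<in> max_sum L" "v \<in> max_sum L" for u v
    using that subspace_add[OF assms] by (auto simp: max_sum_def)
  show "fun_scale s c u \<in> max_sum L" if "u \<in> max_sum L" for c u
    using that subspace_scale[OF assms] by (auto simp: max_sum_def fun_scale_apply)
qed

end

context peak_string
begin

text \<open>\<open>hh z (vv z) = 1\<close> on the string makes the rank one family idempotent, and
  it is not zero as it fixes \<open>v\<close> at \<open>zz m\<close>. By indecomposability it is the
  identity on every \<open>U x\<close>.\<close>

lemma indecomposable_thin_string:
  assumes "indecomposable_peak_space s U"
  obtains k vv hh where "thin_string k m vv hh" "\<And>x u z. u \<in> U x \<Longrightarrow> u z = s (hh z (u z)) (vv z)"
proof -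
  obtain v h where vh: "thin m v h"
    using thin_last by blast
  then obtain k vv hh where str: "thin_string k m vv hh" and vv: "vv (zz m) = v" and hh: "hh (zz m) = h"
    using thin_string_exists[of m v h] by blast
  have func: "\<And>z. functional (hh z)" and out: "\<And>z. z \<notin> zz ` {k..m} \<Longrightarrow> vv z = 0"
    and one: "\<And>z. z \<in> zz ` {k..m} \<Longrightarrow> hh z (vv z) = 1"
    and inv: "\<And>x u. u \<in> U x \<Longrightarrow> peak_endo (rank1 vv hh) u \<in> U x"
    using str unfolding thin_string_def by auto
  have lin: "linear_family (rank1 vv hh)"
    by (simp add: linear_family_def rank1_def functional_add[OF func] functional_scale[OF func] scale_left_distrib)
  have idem: "rank1 vv hh z (rank1 vv hh z a) = rank1 vv hh z a" for z a
    using one[of z] out[of z] by (cases "z \<in> zz ` {k..m}") (simp_all add: rank1_def functional_scale[OF func])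
  have h: "functional h" "h v = 1" "at_point (zz m) v \<in> U (zz m)"
    using vh by (auto simp: thin_def summand_def)
  have "peak_endo (rank1 vv hh) (at_point (zz m) v) (zz m) = v"
    using h vv hh by (simp add: peak_endo_def rank1_def at_point_def)
  moreover have "v \<noteq> 0"
    using h functional_0[OF h(1)] by auto
  ultimately have "peak_endo (rank1 vv hh) (at_point (zz m) v) \<noteq> 0"
    by (metis zero_fun_apply)
  then have "peak_endo (rank1 vv hh) u = u" if "u \<in> U x" for u x
    using indecomposable_idempotent[OF assms lin idem _ h(3) _ that] inv by blast
  then have "u z = s (hh z (u z)) (vv z)" if "u \<in> U x" for u x z
    using that by (metis peak_endo_apply rank1_def)
  with str that show thesis by blast
qed

lemma stable:
  assumes "indecomposable_peak_space s U"
  shows "\<exists>\<theta> :: ('p \<Rightarrow> int) \<Rightarrow> int. additive \<theta> \<and> peak_stable s \<theta> U"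
proof -
  obtain k vv hh where str: "thin_string k m vv hh" and id: "\<And>x u z. u \<in> U x \<Longrightarrow> u z = s (hh z (u z)) (vv z)"
    using indecomposable_thin_string[OF assms] by blast
  have k: "k \<le> m" and func: "\<And>z. functional (hh z)" and out: "\<And>z. z \<notin> zz ` {k..m} \<Longrightarrow> vv z = 0"
    and one: "\<And>z. z \<in> zz ` {k..m} \<Longrightarrow> hh z (vv z) = 1"
    and lnk: "\<And>j. k \<le> j \<Longrightarrow> j < m \<Longrightarrow>
        (\<exists>w\<in>U (link j). w (zz j) = vv (zz j) \<and> w (zz (Suc j)) = vv (zz (Suc j))) \<and>
        (\<forall>u\<in>U (link j). hh (zz j) (u (zz j)) = hh (zz (Suc j)) (u (zz (Suc j))))"
    using str unfolding thin_string_def by blast+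
  have vv_ne: "vv (zz j) \<noteq> 0" if "j \<in> {k..m}" for j
    using one[of "zz j"] functional_0[OF func] that by (metis image_eqI zero_neq_one)
  \<comment> \<open>\<open>zz j\<close> is in the support, so its summand has a nonzero vector; this
    is an invertible multiple of \<open>vv (zz j)\<close>.\<close>
  have vv_in: "vv (zz j) \<in> summand U (zz j)" if j: "j \<in> {k..m}" for j
  proof -
    obtain u where u: "u \<in> U (zz j)" "u \<noteq> 0"
      using zz_support[of j] j F.subspace_0[OF subspace_U[of "zz j"]] by (auto simp: support_def)
    have a: "u (zz j) \<in> summand U (zz j)"
      using U_summand[OF u(1)] zz_max j by simp
    have "u (zz j) \<noteq> 0"
    proof
      assume "u (zz j) = 0"
      then have "u = at_point (zz j) 0"
        using U_max[of "zz j" u] zz_max[of j] u(1) j by simp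
      then show False
        using u(2) at_point_0 by metis
    qed
    moreover obtain c where c: "u (zz j) = s c (vv (zz j))"
      using id[OF u(1)] by blast
    ultimately have "c \<noteq> 0"
      by auto
    then have "vv (zz j) = s (inverse c) (u (zz j))"
      unfolding c by simp
    then show ?thesis
      using subspace_scale[OF subspace_V a] by metis
  qed
  define n where "n = m - k + 1"
  \<comment> \<open>Points other than the string peaks and their links get weight 0. For
    \<open>n = 1\<close> the whole weight is 0, which is enough because a single line has no proper
    nonzero subspace.\<close>
  define \<theta> :: "('p \<Rightarrow> int) \<Rightarrow> int" where
    "\<theta> d = int n * (\<Sum>j\<in>{k..<m}. d (link j)) - int (n - 1) * (\<Sum>j\<in>{k..m}. d (zz j))" for d
  have "additive \<theta>"
    by (rule additive.intro) (simp add: \<theta>_def sum.distrib algebra_simps)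
  \<comment> \<open>The positions of the lines contained in the admissible subspace given by
    \<open>L\<close>.\<close>
  define S where "S L = {j \<in> {k..m}. vv (zz j) \<in> L (zz j)}" for L :: "'p \<Rightarrow> 'v set"
  have S_fin: "finite (S L)" for L
    by (simp add: S_def)
  \<comment> \<open>Each intersection is zero or a full line; a diagonal lies in the admissible
    subspace exactly if both of its components do.\<close>
  have \<theta>_eq: "\<theta> (dim_vector s (restrict_peak_space U (max_sum L))) =
      int n * int (card {j. j \<in> S L \<and> Suc j \<in> S L}) - int (n - 1) * int (card (S L))"
    if L: "\<And>z. z \<in> max_points \<Longrightarrow> subspace (L z)" for L
  proof -
    let ?K = "max_sum L"
    have K: "F.subspace (?K \<inter> U x)" for x
      using subspace_max_sum[OF L] subspace_U[of x] by (rule F.subspace_inter)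
    have dim_z: "F.dim (?K \<inter> U (zz j)) = (if j \<in> S L then 1 else 0)" if j: "j \<in> {k..m}" for j
    proof -
      let ?w = "at_point (zz j) (vv (zz j))"
      have zj: "zz j \<in> max_points" "zz j \<in> support"
        using zz_max zz_support j by auto
      have line: "u = fun_scale s (hh (zz j) (u (zz j))) ?w" if "u \<in> U (zz j)" for u
      proof
        fix z
        show "u z = fun_scale s (hh (zz j) (u (zz j))) ?w z"
          using id[OF that, of z] fun_cong[OF U_max[OF zj(1) that], of z]
          by (cases "z = zz j") (simp_all add: fun_scale_apply at_point_def)
      qed
      have w0: "?w \<noteq> 0"
        using vv_ne[OF j] by (auto simp: at_point_def fun_eq_iff)
      have ex: "\<exists>c. u = fun_scale s c ?w" if "u \<in> ?K \<inter> U (zz j)" for u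
        using line that by blast
      have "?w \<in> U (zz j)"
        using vv_in[OF j] by (simp add: summand_def)
      moreover have "?w \<in> ?K \<longleftrightarrow> vv (zz j) \<in> L (zz j)"
        using subspace_0[OF L] zj(1) by (auto simp: max_sum_def at_point_def)
      ultimately show ?thesis
        using dim_line[OF K w0 ex] j by (simp add: S_def)
    qed
    have dim_l: "F.dim (?K \<inter> U (link j)) = (if j \<in> S L \<and> Suc j \<in> S L then 1 else 0)" if j: "j \<in> {k..<m}" for j
    proof -
      have jm: "j < m" "k \<le> j" and j': "j \<in> {k..m}" "Suc j \<in> {k..m}"
        using j by auto
      have zj: "zz j \<in> max_points" "zz (Suc j) \<in> max_points"
        using zz_max j' by auto
      obtain w where w: "w \<in> U (link j)" "w (zz j) = vv (zz j)" "w (zz (Suc j)) = vv (zz (Suc j))"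
        using lnk[of j] jm by blast
      have off: "u z = 0" if "u \<in> U (link j)" "z \<noteq> zz j" "z \<noteq> zz (Suc j)" for u z
        using link_support[OF jm(1)] that by blast
      have line: "u = fun_scale s (hh (zz j) (u (zz j))) w" if u: "u \<in> U (link j)" for u
      proof
        fix z
        consider "z = zz j" | "z = zz (Suc j)" | "z \<noteq> zz j" "z \<noteq> zz (Suc j)" by blast
        then show "u z = fun_scale s (hh (zz j) (u (zz j))) w z"
        proof cases
          case 1
          then show ?thesis using id[OF u, of "zz j"] w by (simp add: fun_scale_apply)
        next
          case 2
          have "hh (zz j) (u (zz j)) = hh (zz (Suc j)) (u (zz (Suc j)))"
            using lnk[of j] jm u by blast
          then show ?thesis using 2 id[OF u, of "zz (Suc j)"] w by (simp add: fun_scale_apply)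
        next
          case 3
          then show ?thesis using off[OF u] off[OF w(1)] by (simp add: fun_scale_apply)
        qed
      qed
      have w0: "w \<noteq> 0"
        using vv_ne[OF j'(1)] w(2) by auto
      have "w \<in> ?K \<longleftrightarrow> vv (zz j) \<in> L (zz j) \<and> vv (zz (Suc j)) \<in> L (zz (Suc j))"
      proof
        assume "w \<in> ?K"
        then have "\<forall>z\<in>max_points. w z \<in> L z"
          unfolding max_sum_def by simp
        then show "vv (zz j) \<in> L (zz j) \<and> vv (zz (Suc j)) \<in> L (zz (Suc j))"
          using zj w by metis
      next
        assume vL: "vv (zz j) \<in> L (zz j) \<and> vv (zz (Suc j)) \<in> L (zz (Suc j))"
        have "w z \<in> L z" if "z \<in> max_points" for z
          using vL w off[OF w(1), of z] subspace_0[OF L[OF that]] by (cases "z = zz j \<or> z = zz (Suc j)") auto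
        then show "w \<in> ?K"
          using U_max_points[OF w(1)] by (simp add: max_sum_def)
      qed
      moreover have ex: "\<exists>c. u = fun_scale s c w" if "u \<in> ?K \<inter> U (link j)" for u
        using line that by blast
      ultimately have "w \<in> ?K \<inter> U (link j) \<longleftrightarrow> j \<in> S L \<and> Suc j \<in> S L"
        using w(1) j' by (simp add: S_def)
      then show ?thesis
        using dim_line[OF K w0 ex] by simp
    qed
    have "(\<Sum>j\<in>{k..m}. int (F.dim (?K \<inter> U (zz j)))) = (\<Sum>j\<in>{k..m}. if j \<in> S L then 1 else 0)"
      by (rule sum.cong) (auto simp: dim_z)
    also have "\<dots> = int (card ({k..m} \<inter> S L))"
      by (simp add: sum.If_cases Int_def)
    also have "{k..m} \<inter> S L = S L"
      by (auto simp: S_def)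
    finally have sum_z: "(\<Sum>j\<in>{k..m}. int (F.dim (?K \<inter> U (zz j)))) = int (card (S L))" .
    have "(\<Sum>j\<in>{k..<m}. int (F.dim (?K \<inter> U (link j)))) = (\<Sum>j\<in>{k..<m}. if j \<in> S L \<and> Suc j \<in> S L then 1 else 0)"
      by (rule sum.cong) (auto simp: dim_l)
    also have "\<dots> = int (card ({k..<m} \<inter> {j. j \<in> S L \<and> Suc j \<in> S L}))"
      by (simp add: sum.If_cases)
    also have "{k..<m} \<inter> {j. j \<in> S L \<and> Suc j \<in> S L} = {j. j \<in> S L \<and> Suc j \<in> S L}"
      by (auto simp: S_def)
    finally have sum_l: "(\<Sum>j\<in>{k..<m}. int (F.dim (?K \<inter> U (link j)))) = int (card {j. j \<in> S L \<and> Suc j \<in> S L})" .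
    show ?thesis
      unfolding \<theta>_def dim_vector_def restrict_peak_space_def sum_z sum_l ..
  qed
  \<comment> \<open>Every summand is spanned by \<open>vv z\<close>, and is zero off the string.
    Hence \<open>S L\<close> determines the admissible subspace.\<close>
  have multiple: "\<exists>c. a = s c (vv z)" if "a \<in> summand U z" for a z
  proof -
    have "at_point z a \<in> U z"
      using that by (simp add: summand_def)
    from id[OF this, of z] show ?thesis
      by (auto simp: at_point_def)
  qed
  \<comment> \<open>All \<open>n\<close> lines and \<open>n - 1\<close> diagonals are present, so
    the two contributions \<open>n * (n - 1)\<close> cancel.\<close>
  have "\<theta> (dim_vector s U) = 0"
  proof -
    have full: "S (summand U) = {k..m}"
    proof -
      show ?thesis
        using vv_in by (auto simp: S_def)
    qed
    have "restrict_peak_space U (max_sum (summand U)) = U"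
      using peak_space by (auto simp: restrict_peak_space_def peak_space_def ambient_def fun_eq_iff)
    moreover have "{j. j \<in> {k..m} \<and> Suc j \<in> {k..m}} = {k..<m}"
      by auto
    ultimately show ?thesis
      using \<theta>_eq[of "summand U", OF subspace_summand] k unfolding full by (simp add: n_def)
  qed
  moreover have "\<theta> (dim_vector s (restrict_peak_space U K)) < 0"
    if adm: "admissible s U K" and K0: "K \<noteq> {0}" and K1: "K \<noteq> ambient U" for K
  proof -
    obtain L where L: "\<And>z. z \<in> max_points \<Longrightarrow> subspace (L z)" "\<And>z. z \<in> max_points \<Longrightarrow> L z \<subseteq> summand U z"
      and K: "K = max_sum L"
      using adm unfolding admissible_def by blast
    \<comment> \<open>A nonzero vector of \<open>K\<close> has a nonzero coordinate, and then
      \<open>L\<close> contains the whole line there.\<close>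
    have "S L \<noteq> {}"
    proof
      assume S0: "S L = {}"
      have "u = 0" if "u \<in> K" for u
      proof
        fix z
        show "u z = 0 z"
        proof (rule ccontr)
          assume "u z \<noteq> 0 z"
          then have uz: "u z \<noteq> 0" by simp
          then have z: "z \<in> max_points" "u z \<in> L z"
            using that unfolding K max_sum_def by (auto split: if_splits dest: spec[of _ z])
          then obtain c where c: "u z = s c (vv z)"
            using multiple L(2) by blast
          have "c \<noteq> 0" "vv z \<noteq> 0"
            using c uz by auto
          then have "vv z = s (inverse c) (u z)"
            unfolding c by simp
          then have "vv z \<in> L z"
            using subspace_scale[OF L(1)[OF z(1)] z(2)] by metis
          moreover obtain j where "j \<in> {k..m}" "z = zz j"
            using out[of z] \<open>vv z \<noteq> 0\<close> by blast
          ultimately show False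
            using S0 by (auto simp: S_def)
        qed
      qed
      moreover have "0 \<in> K"
        unfolding K using F.subspace_0[OF subspace_max_sum[OF L(1)]] .
      ultimately show False
        using K0 by blast
    qed
    moreover have "S L \<noteq> {k..m}"
    proof
      assume "S L = {k..m}"
      then have vL: "vv (zz j) \<in> L (zz j)" if "j \<in> {k..m}" for j
        using that unfolding S_def by blast
      have "summand U z \<subseteq> L z" if z: "z \<in> max_points" for z
      proof
        fix a assume "a \<in> summand U z"
        then obtain c where c: "a = s c (vv z)"
          using multiple by blast
        have "vv z \<in> L z"
          using vL out[of z] subspace_0[OF L(1)[OF z]] by (cases "z \<in> zz ` {k..m}") auto
        then show "a \<in> L z"
          unfolding c by (rule subspace_scale[OF L(1)[OF z]])
      qed
      then have "L z = summand U z" if "z \<in> max_points" for z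
        using L(2) that by blast
      then have "K = ambient U"
        unfolding K ambient_def max_sum_def by (intro Collect_cong) simp
      then show False
        using K1 by simp
    qed
    moreover have "S L \<subseteq> {k..m}"
      by (auto simp: S_def)
    ultimately have less: "card {j. j \<in> S L \<and> Suc j \<in> S L} < card (S L)" "card (S L) < card {k..m}"
      using card_consecutive_less[OF S_fin] by (blast, intro psubset_card_mono) auto
    define p c where "p = int (card {j. j \<in> S L \<and> Suc j \<in> S L})" and "c = int (card (S L))"
    have pc: "p \<le> c - 1" "c < int n"
      using less k by (auto simp: p_def c_def n_def)
    have "int n * p \<le> int n * (c - 1)"
      using pc(1) by (intro mult_left_mono) auto
    moreover have "int (n - 1) = int n - 1"
      by (simp add: n_def)
    ultimately have "int n * p - int (n - 1) * c < 0"
      using pc(2) by (simp add: algebra_simps)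
    then show ?thesis
      using \<theta>_eq[OF L(1)] unfolding K p_def c_def by simp
  qed
  ultimately show ?thesis
    using \<open>additive \<theta>\<close> unfolding peak_stable_def by blast
qed

end

theorem theorem2p6:
  fixes s :: "'k::field \<Rightarrow> 'v::ab_group_add \<Rightarrow> 'v"
    and U :: "'p::{finite, order} \<Rightarrow> ('p \<Rightarrow> 'v) set"
  assumes "vector_space s"
    and "type_A TYPE('p)"
    and "indecomposable_peak_space s U"
  shows "\<exists>\<theta> :: ('p \<Rightarrow> int) \<Rightarrow> int. additive \<theta> \<and> peak_stable s \<theta> U"
proof -
  interpret vector_space s by fact
  have U: "peak_space s U" "\<not> zero_peak_space U"
    using assms(3) by (auto simp: indecomposable_peak_space_def)
  interpret peak_space_locale s U
    by unfold_locales (rule U)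
  interpret type_A_poset "TYPE('p)"
    by unfold_locales (rule assms)
  \<comment> \<open>A nonzero vector has a nonzero coordinate, so the support is not empty and has a
    component.\<close>
  obtain x where "U x \<noteq> {0}"
    using U(2) by (auto simp: zero_peak_space_def)
  then obtain u where u: "u \<in> U x" "u \<noteq> 0"
    using F.subspace_0[OF subspace_U[of x]] by blast
  then obtain z where "u z \<noteq> 0"
    by (auto simp: fun_eq_iff)
  then have ne: "support \<noteq> {}"
    using U_support(1)[OF u(1)] by blast
  have sub: "support \<subseteq> max_points"
    by (auto simp: support_def)
  \<comment> \<open>The path is one component of the support; that it carries all of
    \<open>U\<close> comes out later, from indecomposability.\<close>
  obtain m zz where zz: "inj_on zz {..m}" "zz ` {..m} \<subseteq> support"
    "\<And>j. j < m \<Longrightarrow> linked (zz j) (zz (Suc j))"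
    "\<And>j y. j \<le> m \<Longrightarrow> y \<in> support \<Longrightarrow> linked (zz j) y \<Longrightarrow> \<exists>k\<le>m. y = zz k \<and> (k = Suc j \<or> j = Suc k)"
    by (rule component_is_path[OF sub ne]) (rule that; assumption)
  interpret peak_string s U m zz
    by unfold_locales (use zz in blast)+
  show ?thesis
    using assms(3) by (rule stable)
qed

end
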